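(* Let $n\in\{2,3\}$ and consider the system (zero shear viscosity) on $\mathbb R^n$ $$\begin{cases} \partial_t\rho+\mathrm{div}(\rho u)=0,\\ \rho\partial_t u+\rho u\cdot\nabla u+\nabla p=\nabla S_2,\\ \rho\partial_t e+\rho u\cdot\nabla e+p\,\mathrm{div}u+\mathrm{div}q=S_2\,\mathrm{div}u,\\ \tau_1(\partial_t q+u\cdot\nabla q)+q+\kappa\nabla\theta=0,\\ \tau_3(\partial_t S_2+u\cdot\nabla S_2)+S_2=\lambda\,\mathrm{div}u, \end{cases}$$ with $e=C_v\theta+\frac{\tau_1}{\kappa\rho\theta}q^2+\frac{\tau_3}{2\lambda\rho}S_2^2$, $p=R\rho\theta-\frac{\tau_1}{2\kappa\theta}q^2-\frac{\tau_3}{2\lambda}S_2^2$ and initial data $(\rho_0,u_0,\theta_0,q_0,S_{20})$. Let $(\rho,u,\theta,q,S_2)$ denote the local solution on $[0,T_0)$ described in the context, where $[0,T_0)$ is the maximal interval of existence of a smooth solution. Assume that $(\rho_0-1,u_0,\theta_0-1,q_0,S_{20})$ is compactly supported in the ball $B_0(M)$ of radius $M>0$ centered at $0$, and assume $$G(0)>0,\qquad 1<\gamma:=1+\frac{R}{C_v}<\frac53 .$$ Then, provided the compact support of the initial data is sufficiently large (i.e. $M$ is sufficiently large), there exists $u_0$ (such that the data satisfy $(\rho_0-1,u_0,\theta_0-1,q_0,S_{20})\in H^s(\mathbb R^n)$ with $s>\frac n2+1$, $\min_x(\rho_0(x),\theta_0(x))>0$, $\max_x(|q_0(x)|,|S_{20}(x)|)\le\frac\delta2$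 with $\delta>0$ sufficiently small, $(\rho_0-1,u_0,\theta_0-1,q_0,S_{20})$ is compactly supported in $B_0(M)$, and $G(0)>0$) satisfying $$F(0)>\max\left\{\frac{128\,\sigma\max\rho_0}{3(5-3\gamma)},\ \frac{8\sqrt{\pi\max\rho_0}}{\sqrt{3(5-3\gamma)}}\right\}M^4,$$ such that the length $T_0$ of the maximal interval of existence of the smooth solution is finite.
   Context: $\tau_1,\tau_3,\kappa,\lambda,C_v,R$ are positive constants; $q^2=|q|^2$, $u^2=|u|^2$. Local solution: fix $s>\frac n2+1$. The initial data satisfy $(\rho_0-1,u_0,\theta_0-1,q_0,S_{20})\in H^s(\mathbb R^n)$, $\min_{x}(\rho_0(x),\theta_0(x))>0$ and $\max_x(|q_0(x)|,|S_{20}(x)|)\le\frac\delta2$ with $\delta>0$ sufficiently small. For such data there is a unique local solution with $(\rho-1,u,\theta-1,q,S_2)\in C^0([0,T_0),H^s)\cap C^1([0,T_0),H^{s-1})$, $\min_{(x,t)}(\rho,\theta)>0$ and $\max_{(x,t)}(|q|,|S_2|)\le\delta$ on $\mathbb R^n\times[0,T_0)$. Finite propagation speed: $\sigma>0$ denotes a constant such that, when $(\rho_0-1,u_0,\theta_0-1,q_0,S_{20})$ is supported in $B_0(M)$, the solution satisfies $(\rho,u,\theta,q,S_2)(x,t)=(1,0,1,0,0)$ for all $|x|\ge M+\sigma t$, $0\le t<T_0$ (such a constant exists). Averaged quantities: $$F(t):=\int_{\mathbb R^n}x\cdot\rho(x,t)u(x,t)\,dx,\qquad G(t):=\int_{\mathbb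 R^n}\left(\mathcal E(x,t)-\bar{\mathcal E}\right)dx,$$ where $\mathcal E:=\rho\left(e+\frac12u^2\right)$ is the total energy and $\bar{\mathcal E}:=C_v$ is its value at the equilibrium $(\rho,u,\theta,q,S_2)=(1,0,1,0,0)$. In particular $F(0)$ and $G(0)$ are computed from the initial data, and $\max\rho_0=\max_{x\in\mathbb R^n}\rho_0(x)$. *)

theory Defs
  imports "HOL-Analysis.Analysis"
begin

section \<open>Sobolev spaces of real order\<close>

definition square_integrable :: "('a::euclidean_space \<Rightarrow> complex) \<Rightarrow> bool" where
  "square_integrable f \<longleftrightarrow>
     f \<in> borel_measurable lborel \<and> integrable lborel (\<lambda>x. (cmod (f x))\<^sup>2)"

definition fourier :: "('a::euclidean_space \<Rightarrow> complex) \<Rightarrow> 'a \<Rightarrow> complex" where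
  "fourier f \<xi> = (LINT x|lborel. cis (- (\<xi> \<bullet> x)) * f x)"

text \<open>\<open>plancherel f g\<close>: \<open>g\<close> is (a version of) the \<open>L\<^sup>2\<close> Fourier transform of \<open>f\<close>, that is, the
  \<open>L\<^sup>2\<close> limit of the Fourier integrals of the truncations of \<open>f\<close> to balls.\<close>

definition plancherel ::
    "('a::euclidean_space \<Rightarrow> complex) \<Rightarrow> ('a \<Rightarrow> complex) \<Rightarrow> bool" where
  "plancherel f g \<longleftrightarrow> square_integrable f \<and> square_integrable g \<and>
     ((\<lambda>r. \<integral>\<^sup>+ \<xi>. ennreal ((cmod (g \<xi> - fourier (\<lambda>x. indicator (cball 0 r) x * f x) \<xi>))\<^sup>2) \<partial>lborel)
        \<longlongrightarrow> 0) at_top"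

text \<open>The squared \<open>H\<^sup>s\<close> norm (up to the usual normalisation factor). The transform is unique almost
  everywhere, so the infimum runs over a single value; it is \<open>\<infinity>\<close> if \<open>f\<close> is not in \<open>L\<^sup>2\<close>.\<close>

definition sobolev_sq :: "real \<Rightarrow> ('a::euclidean_space \<Rightarrow> real) \<Rightarrow> ennreal" where
  "sobolev_sq s f =
     (INF g \<in> {g. plancherel (\<lambda>x. complex_of_real (f x)) g}.
        \<integral>\<^sup>+ \<xi>. ennreal ((1 + (norm \<xi>)\<^sup>2) powr s * (cmod (g \<xi>))\<^sup>2) \<partial>lborel)"

definition sobolev :: "real \<Rightarrow> ('a::euclidean_space \<Rightarrow> real) set" where
  "sobolev s = {f. sobolev_sq s f < \<infinity>}"

definition C0_sobolev :: "real \<Rightarrow> real \<Rightarrow> (real \<Rightarrow> 'a::euclidean_space \<Rightarrow> real) \<Rightarrow> bool" where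
  "C0_sobolev T s w \<longleftrightarrow> (\<forall>t\<in>{0..<T}. w t \<in> sobolev s \<and>
     ((\<lambda>r. sobolev_sq s (\<lambda>x. w r x - w t x)) \<longlongrightarrow> 0) (at t within {0..<T}))"

definition C1_sobolev :: "real \<Rightarrow> real \<Rightarrow> (real \<Rightarrow> 'a::euclidean_space \<Rightarrow> real) \<Rightarrow> bool" where
  "C1_sobolev T s w \<longleftrightarrow> C0_sobolev T s w \<and> (\<exists>w'. C0_sobolev T s w' \<and>
     (\<forall>t\<in>{0..<T}. ((\<lambda>r. sobolev_sq s (\<lambda>x. (w r x - w t x) / (r - t) - w' t x)) \<longlongrightarrow> 0)
        (at t within {0..<T})))"

text \<open>Continuously differentiable in time and space on \<open>[0,T) \<times> \<real>\<^sup>n\<close>, one-sided in time at \<open>0\<close>.\<close>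

definition C1_classical :: "real \<Rightarrow> (real \<Rightarrow> 'a::euclidean_space \<Rightarrow> real) \<Rightarrow> bool" where
  "C1_classical T w \<longleftrightarrow> (\<exists>wt wx.
     continuous_on ({0..<T} \<times> UNIV) (\<lambda>(t, x). wt t x :: real) \<and>
     continuous_on ({0..<T} \<times> UNIV) (\<lambda>(t, x). wx t x :: 'a) \<and>
     (\<forall>t\<in>{0..<T}. \<forall>x. ((\<lambda>(r, y). w r y) has_derivative (\<lambda>(h, k). wt t x * h + wx t x \<bullet> k))
        (at (t, x) within {0..<T} \<times> UNIV)))"


section \<open>Differential operators\<close>

definition time_deriv ::
    "real \<Rightarrow> (real \<Rightarrow> 'a \<Rightarrow> 'b::real_normed_vector) \<Rightarrow> real \<Rightarrow> 'a \<Rightarrow> 'b" where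
  "time_deriv T w t x = vector_derivative (\<lambda>r. w r x) (at t within {0..<T})"

definition gradient :: "(real^'n \<Rightarrow> real) \<Rightarrow> real^'n \<Rightarrow> real^'n" where
  "gradient f x = (\<chi> i. frechet_derivative f (at x) (axis i 1))"

definition divergence :: "(real^'n \<Rightarrow> real^'n) \<Rightarrow> real^'n \<Rightarrow> real" where
  "divergence v x = (\<Sum>i\<in>UNIV. frechet_derivative v (at x) (axis i 1) $ i)"

text \<open>\<open>(u \<cdot> \<nabla>) w\<close>, for scalar and vector fields \<open>w\<close> alike\<close>

definition advect ::
    "(real^'n \<Rightarrow> real^'n) \<Rightarrow> (real^'n \<Rightarrow> 'b::real_normed_vector) \<Rightarrow> real^'n \<Rightarrow> 'b" where
  "advect u w x = frechet_derivative w (at x) (u x)"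


section \<open>The relaxed compressible Navier--Stokes system without shear viscosity\<close>

record coeffs =
  tau1 :: real
  tau3 :: real
  kappa :: real
  lam :: real
  cv :: real
  rgas :: real

definition adiabatic_index :: "coeffs \<Rightarrow> real" where
  "adiabatic_index c = 1 + rgas c / cv c"

text \<open>The unknowns at a fixed time, as functions on \<open>\<real>\<^sup>n\<close>: density \<open>\<rho>\<close>, velocity \<open>u\<close>,
  temperature \<open>\<theta>\<close>, heat flux \<open>q\<close> and the scalar stress \<open>S\<^sub>2\<close>.\<close>

record 'n fields =
  rho :: "real^'n \<Rightarrow> real"
  vel :: "real^'n \<Rightarrow> real^'n"
  temp :: "real^'n \<Rightarrow> real"
  flux :: "real^'n \<Rightarrow> real^'n"
  stress :: "real^'n \<Rightarrow> real"

datatype 'n component = Density | Velocity 'n | Temperature | Flux 'n | Stress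

text \<open>The scalar components of \<open>(\<rho> - 1, u, \<theta> - 1, q, S\<^sub>2)\<close>\<close>

primrec pert :: "'n component \<Rightarrow> 'n::finite fields \<Rightarrow> real^'n \<Rightarrow> real" where
  "pert Density d x = rho d x - 1"
| "pert (Velocity i) d x = vel d x $ i"
| "pert Temperature d x = temp d x - 1"
| "pert (Flux i) d x = flux d x $ i"
| "pert Stress d x = stress d x"

definition internal_energy :: "coeffs \<Rightarrow> 'n::finite fields \<Rightarrow> real^'n \<Rightarrow> real" where
  "internal_energy c d x = cv c * temp d x
     + tau1 c / (kappa c * rho d x * temp d x) * (norm (flux d x))\<^sup>2
     + tau3 c / (2 * lam c * rho d x) * (stress d x)\<^sup>2"

definition pressure :: "coeffs \<Rightarrow> 'n::finite fields \<Rightarrow> real^'n \<Rightarrow> real" where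
  "pressure c d x = rgas c * rho d x * temp d x
     - tau1 c / (2 * kappa c * temp d x) * (norm (flux d x))\<^sup>2
     - tau3 c / (2 * lam c) * (stress d x)\<^sup>2"

definition total_energy :: "coeffs \<Rightarrow> 'n::finite fields \<Rightarrow> real^'n \<Rightarrow> real" where
  "total_energy c d x = rho d x * (internal_energy c d x + (norm (vel d x))\<^sup>2 / 2)"

definition F_fun :: "'n::finite fields \<Rightarrow> real" where
  "F_fun d = (LINT x|lborel. x \<bullet> (rho d x *\<^sub>R vel d x))"

definition G_fun :: "coeffs \<Rightarrow> 'n::finite fields \<Rightarrow> real" where
  "G_fun c d = (LINT x|lborel. total_energy c d x - cv c)"

definition solves_system :: "coeffs \<Rightarrow> real \<Rightarrow> (real \<Rightarrow> 'n::finite fields) \<Rightarrow> bool" where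
  "solves_system c T U \<longleftrightarrow> (\<forall>t\<in>{0..<T}. \<forall>x.
     (let \<rho> = rho (U t); u = vel (U t); \<theta> = temp (U t); q = flux (U t); S = stress (U t);
          e = internal_energy c (U t); p = pressure c (U t)
      in
        time_deriv T (\<lambda>r. rho (U r)) t x + divergence (\<lambda>y. \<rho> y *\<^sub>R u y) x = 0 \<and>
        \<rho> x *\<^sub>R time_deriv T (\<lambda>r. vel (U r)) t x + \<rho> x *\<^sub>R advect u u x + gradient p x
          = gradient S x \<and>
        \<rho> x * time_deriv T (\<lambda>r. internal_energy c (U r)) t x + \<rho> x * advect u e x
          + p x * divergence u x + divergence q x = S x * divergence u x \<and>
        tau1 c *\<^sub>R (time_deriv T (\<lambda>r. flux (U r)) t x + advect u q x) + q x
          + kappa c *\<^sub>R gradient \<theta> x = 0 \<and>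
        tau3 c * (time_deriv T (\<lambda>r. stress (U r)) t x + advect u S x) + S x
          = lam c * divergence u x))"

text \<open>Elements of \<open>H\<^sup>s\<close> with \<open>s > n/2 + 1\<close> are identified with their continuous (in fact \<open>C\<^sup>1\<close>)
  representatives; the clauses \<open>continuous_on\<close> and \<open>C1_classical\<close> below only select these and are
  otherwise consequences of the Sobolev embedding.\<close>

definition admissible_data :: "real \<Rightarrow> real \<Rightarrow> 'n::finite fields \<Rightarrow> bool" where
  "admissible_data s \<delta> d \<longleftrightarrow>
     (\<forall>k. pert k d \<in> sobolev s \<and> continuous_on UNIV (pert k d)) \<and>
     (\<exists>m>0. \<forall>x. m \<le> rho d x \<and> m \<le> temp d x) \<and>
     (\<forall>x. norm (flux d x) \<le> \<delta> / 2 \<and> \<bar>stress d x\<bar> \<le> \<delta> / 2)"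

definition supported_in :: "real \<Rightarrow> 'n::finite fields \<Rightarrow> bool" where
  "supported_in M d \<longleftrightarrow> (\<forall>k x. M \<le> norm x \<longrightarrow> pert k d x = 0)"

definition smooth_solution ::
    "coeffs \<Rightarrow> real \<Rightarrow> real \<Rightarrow> 'n::finite fields \<Rightarrow> real \<Rightarrow> (real \<Rightarrow> 'n fields) \<Rightarrow> bool" where
  "smooth_solution c s \<delta> d T U \<longleftrightarrow> 0 < T \<and> U 0 = d \<and>
     (\<forall>k. C0_sobolev T s (\<lambda>t. pert k (U t)) \<and> C1_sobolev T (s - 1) (\<lambda>t. pert k (U t)) \<and>
          C1_classical T (\<lambda>t. pert k (U t))) \<and>
     (\<exists>m>0. \<forall>t\<in>{0..<T}. \<forall>x. m \<le> rho (U t) x \<and> m \<le> temp (U t) x) \<and>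
     (\<forall>t\<in>{0..<T}. \<forall>x. norm (flux (U t) x) \<le> \<delta> \<and> \<bar>stress (U t) x\<bar> \<le> \<delta>) \<and>
     solves_system c T U"

definition locally_solvable :: "coeffs \<Rightarrow> real \<Rightarrow> real \<Rightarrow> 'n::finite fields \<Rightarrow> bool" where
  "locally_solvable c s \<delta> d \<longleftrightarrow> (\<exists>T U. smooth_solution c s \<delta> d T U)"

text \<open>The length of the maximal interval of existence: all solutions with the given data compete, and the
  value is \<open>\<infinity>\<close> iff solutions exist on arbitrarily long intervals.\<close>

definition lifespan :: "coeffs \<Rightarrow> real \<Rightarrow> real \<Rightarrow> 'n::finite fields \<Rightarrow> ereal" where
  "lifespan c s \<delta> d = Sup {ereal T |T. \<exists>U. smooth_solution c s \<delta> d T U}"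

definition propagates_with_speed ::
    "coeffs \<Rightarrow> real \<Rightarrow> real \<Rightarrow> real \<Rightarrow> 'n::finite fields \<Rightarrow> bool" where
  "propagates_with_speed c s \<delta> \<sigma> d \<longleftrightarrow> (\<forall>M>0. \<forall>T U.
     supported_in M d \<longrightarrow> smooth_solution c s \<delta> d T U \<longrightarrow>
       (\<forall>t\<in>{0..<T}. supported_in (M + \<sigma> * t) (U t)))"

end

theory Submission
  imports Defs "HOL-Computational_Algebra.Polynomial" "HOL-Probability.Sinc_Integral"
begin

text \<open>
  Total mass and total momentum are conserved as long as the solution is smooth, because the
  perturbation of the equilibrium has compact support. Hence the first moment of the mass in a
  coordinate direction moves with constant rate, the momentum in that direction. On the other hand it
  is bounded by the total mass times the radius \<open>M + \<sigma> t\<close> of the support. The density does not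
  depend on the choice of the initial velocity and \<open>\<sigma>\<close> is the same for all data, so a velocity of
  sufficiently large amplitude \<open>A\<close> excludes a smooth solution up to time \<open>1\<close>. Since \<open>F(0)\<close> grows
  linearly and \<open>G(0)\<close> quadratically in \<open>A\<close>, the conditions on them hold for large \<open>A\<close> as well.
\<close>

section \<open>Compactly supported functions in Sobolev spaces\<close>

text \<open>The rate identity is \<open>?D 1 - ?D 0 = ?p 0\<close> for the moment \<open>?D\<close>
  and the momentum \<open>?p\<close>. With the support inside radius \<open>K = M + \<sigma>\<close>
  up to time 1, it gives momentum at most \<open>2 * K\<close> times mass, and this is the
  inequality that a large amplitude violates. Momentum is conserved because \<open>S\<^sub>2\<close>
  is scalar: the momentum flux beyond transport is \<open>p - S\<^sub>2\<close>, constant outside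
  the support, so its gradient integrates to zero. Only differentiability of \<open>p\<close> and
  the equation itself enter, no formula for its gradient. All time derivatives are taken over one
  fixed cube containing every support up to time 1, so no moving domain occurs. The analytic
  obstacle is to exhibit a velocity in \<open>sobolev s\<close> for real \<open>s\<close>, where
  membership is defined through the Fourier transform. A truncated polynomial of finite smoothness
  suffices and makes the decay explicit. Two integrals coexist: the Lebesgue integral in the
  definitions of \<open>fourier\<close>, \<open>F_fun\<close> and \<open>G_fun\<close>, and the
  gauge integral over cubes for differentiation under the integral. On continuous functions of
  compact support they agree, which is the bridge supplied here.\<close>

lemma compact_support_integral:
  fixes f :: "'a::euclidean_space \<Rightarrow> 'b::euclidean_space"
  assumes "continuous_on UNIV f" "\<And>x. x \<notin> cbox a b \<Longrightarrow> f x = 0"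
  shows "integrable lborel f" "integral\<^sup>L lborel f = integral (cbox a b) f"
proof -
  have eq: "(\<lambda>x. indicator (cbox a b) x *\<^sub>R f x) = f"
    using assms(2) by (auto simp: fun_eq_iff indicator_def)
  have si: "set_integrable lborel (cbox a b) f"
    unfolding set_integrable_def
    using borel_integrable_compact[OF compact_cbox continuous_on_subset[OF assms(1)], of a b]
    by (simp add: if_distrib indicator_def scaleR_conv_of_real cong: if_cong)
  show "integrable lborel f" using si unfolding set_integrable_def eq .
  show "integral\<^sup>L lborel f = integral (cbox a b) f"
    using set_borel_integral_eq_integral(2)[OF si] unfolding set_lebesgue_integral_def eq .
qed

section \<open>Fourier decay of one-dimensional bumps\<close>

lemma power_Suc_dvd_pderiv:
  fixes p x :: "real poly"
  assumes "x ^ Suc k dvd p"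
  shows "x ^ k dvd pderiv p"
proof -
  obtain q where "p = x ^ Suc k * q" using assms by (elim dvdE)
  then have "pderiv p = x ^ Suc k * pderiv q + q * smult (of_nat (Suc k)) (x ^ k * pderiv x)"
    by (simp only: pderiv_mult pderiv_power_Suc) (simp add: algebra_simps)
  also have "\<dots> = x ^ k * (x * pderiv q + smult (of_nat (Suc k)) (q * pderiv x))"
    by (simp add: algebra_simps smult_add_right)
  finally show ?thesis by simp
qed

text \<open>Each factor of the end point polynomial pays for one integration by parts: the boundary
  terms vanish, \<i>\<xi> times the transform of \<open>p\<close> is the transform of
  \<open>pderiv p\<close>, and differentiation costs only one order of divisibility. The induction
  therefore has to run over all \<open>p\<close>.\<close>

lemma poly_fourier_decay:
  fixes p :: "real poly"
  assumes "l < u" "([:- l, 1:] * [:u, -1:]) ^ k dvd p"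
  shows "\<exists>C. \<forall>\<xi>. \<bar>\<xi>\<bar> ^ k * norm (integral {l..u} (\<lambda>x. cis (- (\<xi> * x)) * of_real (poly p x))) \<le> C"
  using assms(2)
proof (induction k arbitrary: p)
  case 0
  have "norm (integral {l..u} (\<lambda>x. cis (- (\<xi> * x)) * of_real (poly p x)))
      \<le> integral {l..u} (\<lambda>x. \<bar>poly p x\<bar>)" for \<xi>
    by (rule integral_norm_bound_integral)
       (auto intro!: integrable_continuous_interval continuous_intros simp: norm_mult)
  then show ?case by auto
next
  case (Suc k)
  obtain C where C: "\<bar>\<xi>\<bar> ^ k * norm (integral {l..u} (\<lambda>x. cis (- (\<xi> * x)) * of_real (poly (pderiv p) x))) \<le> C"
    for \<xi> using Suc.IH[OF power_Suc_dvd_pderiv[OF Suc.prems]] by blast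
  obtain q where "p = ([:- l, 1:] * [:u, -1:]) ^ Suc k * q" using Suc.prems by (elim dvdE)
  then have ends: "poly p l = 0" "poly p u = 0"
    by (simp_all del: mult_pCons_left mult_pCons_right power_Suc)
  have parts: "\<i> * of_real \<xi> * integral {l..u} (\<lambda>x. cis (- (\<xi> * x)) * of_real (poly p x))
      = integral {l..u} (\<lambda>x. cis (- (\<xi> * x)) * of_real (poly (pderiv p) x))" for \<xi>
  \<comment> \<open>Integrate the derivative of the product of \<open>?e\<close> and
    \<open>p\<close>; it has integral 0 because \<open>p\<close> vanishes at both end
    points.\<close>
  proof -
    let ?e = "\<lambda>x. cis (- (\<xi> * x))"
    have "((\<lambda>x. ?e x * of_real (poly p x)) has_vector_derivative
        (?e x * of_real (poly (pderiv p) x) - \<i> * of_real \<xi> * (?e x * of_real (poly p x))))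
        (at x within {l..u})" for x
    proof -
      have 1: "(?e has_vector_derivative (- \<i> * of_real \<xi> * ?e x)) (at x within {l..u})"
      proof -
        have "((\<lambda>z. exp (\<i> * (- (of_real \<xi> * z)))) has_field_derivative
            (- \<i> * of_real \<xi> * exp (\<i> * (- (of_real \<xi> * of_real x))))) (at (of_real x))"
          by (auto intro!: derivative_eq_intros)
        from has_vector_derivative_real_field[OF this] show ?thesis
          by (simp add: cis_conv_exp)
      qed
      have 2: "((\<lambda>x. complex_of_real (poly p x)) has_vector_derivative of_real (poly (pderiv p) x))
          (at x within {l..u})"
        by (rule has_vector_derivative_of_real, rule has_field_derivative_at_within, rule poly_DERIV)
      show ?thesis
        using has_vector_derivative_mult[OF 1 2] by (simp add: algebra_simps)
    qed
    then have "((\<lambda>x. ?e x * of_real (poly (pderiv p) x) - \<i> * of_real \<xi> * (?e x * of_real (poly p x)))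
        has_integral 0) {l..u}"
      using fundamental_theorem_of_calculus[of l u "\<lambda>x. ?e x * of_real (poly p x)"] assms(1)
      by (simp add: ends)
    then have "integral {l..u} (\<lambda>x. ?e x * of_real (poly (pderiv p) x) - \<i> * of_real \<xi> * (?e x * of_real (poly p x))) = 0"
      by (rule integral_unique)
    moreover have "integral {l..u} (\<lambda>x. ?e x * of_real (poly (pderiv p) x) - \<i> * of_real \<xi> * (?e x * of_real (poly p x)))
      = integral {l..u} (\<lambda>x. ?e x * of_real (poly (pderiv p) x))
        - integral {l..u} (\<lambda>x. \<i> * of_real \<xi> * (?e x * of_real (poly p x)))"
      by (rule integral_diff) (auto intro!: integrable_continuous_interval continuous_intros)
    ultimately show ?thesis by simp
  qed
  have "\<bar>\<xi>\<bar> ^ Suc k * norm (integral {l..u} (\<lambda>x. cis (- (\<xi> * x)) * of_real (poly p x))) \<le> C" for \<xi>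
  proof -
    have "\<bar>\<xi>\<bar> * norm (integral {l..u} (\<lambda>x. cis (- (\<xi> * x)) * of_real (poly p x)))
       = norm (\<i> * of_real \<xi> * integral {l..u} (\<lambda>x. cis (- (\<xi> * x)) * of_real (poly p x)))"
      by (simp add: norm_mult)
    moreover have "\<bar>\<xi>\<bar> ^ Suc k * N = \<bar>\<xi>\<bar> ^ k * (\<bar>\<xi>\<bar> * N)" for N by simp
    ultimately show ?thesis using C[of \<xi>] unfolding parts by metis
  qed
  then show ?case by blast
qed

text \<open>Vanishing to order \<open>k\<close> at the end points makes the Fourier transform decay like \<open>\<bar>\<xi>\<bar>\<^sup>-\<^sup>k\<close>. The
  product form of \<open>box_bump\<close> below lets the Fourier integral factorise, so that the one-dimensional
  decay suffices in every dimension.\<close>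

definition bump :: "nat \<Rightarrow> real \<Rightarrow> real \<Rightarrow> real \<Rightarrow> real" where
  "bump k r a x = max 0 (r\<^sup>2 - (x - a)\<^sup>2) ^ k"

lemma continuous_on_bump [continuous_intros]:
  "continuous_on S f \<Longrightarrow> continuous_on S (\<lambda>x. bump k r a (f x))"
  unfolding bump_def by (intro continuous_intros)

lemma bump_nonneg: "0 \<le> bump k r a x"
  by (simp add: bump_def)

lemma bump_eq_0:
  assumes "0 < r" "0 < k" "r \<le> \<bar>x - a\<bar>"
  shows "bump k r a x = 0"
proof -
  have "r\<^sup>2 \<le> (x - a)\<^sup>2" using assms by (simp add: abs_le_square_iff[symmetric])
  then show ?thesis using assms by (simp add: bump_def)
qed

text \<open>Factoring the difference of squares into the two end point factors is what makes the
  divisibility hypothesis of \<open>poly_fourier_decay\<close> hold with exponent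
  \<open>k\<close>.\<close>

lemma bump_eq_poly:
  assumes "\<bar>x - a\<bar> \<le> r"
  shows "bump k r a x = poly (([:- (a - r), 1:] * [:a + r, -1:]) ^ k) x"
proof -
  have "(x - a)\<^sup>2 \<le> r\<^sup>2" using assms by (metis power2_abs abs_ge_zero power_mono)
  moreover have "r\<^sup>2 - (x - a)\<^sup>2 = (r - a + x) * (a + r - x)"
    by (simp add: power2_eq_square algebra_simps)
  ultimately show ?thesis
    by (simp add: bump_def poly_power del: mult_pCons_left mult_pCons_right)
qed

lemma bump_integrable:
  assumes "0 < r" "0 < k"
  shows "integrable lborel (\<lambda>x. cis (- (\<xi> * x)) * of_real (bump k r a x))"
    and "(LINT x|lborel. cis (- (\<xi> * x)) * of_real (bump k r a x))
      = integral {a - r..a + r} (\<lambda>x. cis (- (\<xi> * x)) * of_real (bump k r a x))"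
proof -
  have *: "bump k r a x = 0" if "x \<notin> cbox (a - r) (a + r)" for x
    using that assms by (intro bump_eq_0) auto
  have c: "continuous_on UNIV (\<lambda>x. cis (- (\<xi> * x)) * of_real (bump k r a x))"
    by (intro continuous_intros)
  show "integrable lborel (\<lambda>x. cis (- (\<xi> * x)) * of_real (bump k r a x))"
    using compact_support_integral(1)[OF c, of "a - r" "a + r"] * by auto
  show "(LINT x|lborel. cis (- (\<xi> * x)) * of_real (bump k r a x))
      = integral {a - r..a + r} (\<lambda>x. cis (- (\<xi> * x)) * of_real (bump k r a x))"
    using compact_support_integral(2)[OF c, of "a - r" "a + r"] * by auto
qed

lemma bump_fourier_decay:
  assumes "0 < r" "0 < k" "j \<le> k"
  shows "\<exists>C. \<forall>\<xi>. \<bar>\<xi>\<bar> ^ j * norm (fourier (\<lambda>x. of_real (bump k r a x)) \<xi>) \<le> C"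
proof -
  have "\<exists>C. \<forall>\<xi>. \<bar>\<xi>\<bar> ^ j * norm (integral {a - r..a + r}
      (\<lambda>x. cis (- (\<xi> * x)) * of_real (poly (([:- (a - r), 1:] * [:a + r, -1:]) ^ k) x))) \<le> C"
    using assms by (intro poly_fourier_decay le_imp_power_dvd) auto
  moreover have "integral {a - r..a + r}
      (\<lambda>x. cis (- (\<xi> * x)) * of_real (poly (([:- (a - r), 1:] * [:a + r, -1:]) ^ k) x))
     = fourier (\<lambda>x. of_real (bump k r a x)) \<xi>" for \<xi>
    unfolding fourier_def inner_real_def bump_integrable(2)[OF assms(1,2)]
    by (intro integral_cong) (auto simp: bump_eq_poly abs_le_iff simp del: mult_pCons_left mult_pCons_right)
  ultimately show ?thesis by simp
qed

lemma borel_measurable_fourier: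
  fixes f :: "'a::euclidean_space \<Rightarrow> complex"
  assumes [measurable]: "f \<in> borel_measurable borel"
  shows "fourier f \<in> borel_measurable borel"
proof -
  have "cis \<in> borel_measurable borel"
    by (intro borel_measurable_continuous_onI continuous_intros)
  note [measurable] = this
  show ?thesis unfolding fourier_def[abs_def] by measurable
qed

text \<open>One power of 1 + \<xi>^2 is held back: decay of order \<open>k\<close> with
  \<open>s + 1 \<le> k\<close> bounds the integrand even with weight exponent \<open>s + 1\<close>,
  so the true integrand is at most a constant times the integrable 1 / (1 + \<xi>^2).\<close>

lemma bump_fourier_weighted:
  assumes "0 < r" "0 < k" "0 \<le> s" "s + 1 \<le> real k"
  shows "(\<integral>\<^sup>+ \<xi>. ennreal ((1 + \<xi>\<^sup>2) powr s * (cmod (fourier (\<lambda>x. of_real (bump k r a x)) \<xi>))\<^sup>2) \<partial>lborel) < \<infinity>"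
proof -
  let ?f = "fourier (\<lambda>x::real. complex_of_real (bump k r a x))"
  obtain C0 where C0: "\<bar>\<xi>\<bar> ^ 0 * norm (?f \<xi>) \<le> C0" for \<xi> using bump_fourier_decay[OF assms(1,2), of 0] by auto
  obtain C1 where C1: "\<bar>\<xi>\<bar> ^ k * norm (?f \<xi>) \<le> C1" for \<xi> using bump_fourier_decay[OF assms(1,2), of k] by auto
  \<comment> \<open>The factor 2 comes from 1 + \<xi>^2 \<le> 2 max(1, \<xi>^2). \<open>C0\<close>
    serves the range |\<xi>| \<le> 1, \<open>C1\<close> the range |\<xi>| > 1.\<close>
  define K where "K = 2 powr (s + 1) * (max C0 C1)\<^sup>2"
  have K: "(1 + \<xi>\<^sup>2) powr s * (cmod (?f \<xi>))\<^sup>2 \<le> K * inverse (1 + \<xi>\<^sup>2)" for \<xi>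
  proof -
    have p: "0 < 1 + \<xi>\<^sup>2" by (simp add: add_pos_nonneg)
    have "(1 + \<xi>\<^sup>2) powr (s + 1) * (cmod (?f \<xi>))\<^sup>2 \<le> K"
    proof (cases "\<bar>\<xi>\<bar> \<le> 1")
      case True
      then have "\<xi>\<^sup>2 \<le> 1" by (simp add: abs_square_le_1)
      then have "(1 + \<xi>\<^sup>2) powr (s + 1) \<le> 2 powr (s + 1)" using assms by (intro powr_mono2) auto
      moreover have "(cmod (?f \<xi>))\<^sup>2 \<le> (max C0 C1)\<^sup>2" using C0[of \<xi>] by (intro power_mono) auto
      ultimately show ?thesis unfolding K_def by (intro mult_mono) auto
    next
      case False
      then have x: "1 \<le> \<bar>\<xi>\<bar>" by simp
      then have x2: "1 \<le> \<xi>\<^sup>2" by (metis abs_1 abs_le_square_iff abs_abs power_one)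
      have "(1 + \<xi>\<^sup>2) powr (s + 1) \<le> (2 * \<xi>\<^sup>2) powr (s + 1)" using assms x2 by (intro powr_mono2) auto
      also have "\<dots> = 2 powr (s + 1) * (\<xi>\<^sup>2) powr (s + 1)" by (simp add: powr_mult)
      also have "(\<xi>\<^sup>2) powr (s + 1) \<le> (\<xi>\<^sup>2) powr real k" using assms x2 by (intro powr_mono) auto
      also have "(\<xi>\<^sup>2) powr real k = (\<bar>\<xi>\<bar> ^ k)\<^sup>2"
        using x2 by (subst powr_realpow) (auto simp: power_mult_distrib[symmetric] power2_eq_square)
      finally have "(1 + \<xi>\<^sup>2) powr (s + 1) * (cmod (?f \<xi>))\<^sup>2
          \<le> 2 powr (s + 1) * (\<bar>\<xi>\<bar> ^ k)\<^sup>2 * (cmod (?f \<xi>))\<^sup>2"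
        by (intro mult_right_mono) auto
      also have "\<dots> = 2 powr (s + 1) * (\<bar>\<xi>\<bar> ^ k * cmod (?f \<xi>))\<^sup>2" by (simp add: power_mult_distrib)
      also have "\<dots> \<le> K" unfolding K_def using C1[of \<xi>]
        by (intro mult_left_mono power_mono) auto
      finally show ?thesis .
    qed
    then show ?thesis using p by (simp add: powr_add field_simps)
  qed
  have K0: "0 \<le> K" by (simp add: K_def)
  have "(\<integral>\<^sup>+ \<xi>. ennreal ((1 + \<xi>\<^sup>2) powr s * (cmod (?f \<xi>))\<^sup>2) \<partial>lborel)
      \<le> (\<integral>\<^sup>+ \<xi>. ennreal (K * inverse (1 + \<xi>\<^sup>2)) \<partial>lborel)"
    by (intro nn_integral_mono ennreal_leI K)
  also have "\<dots> < \<infinity>"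
  proof -
    have "integrable lborel (\<lambda>\<xi>::real. K * inverse (1 + \<xi>\<^sup>2))"
      using integrable_inverse_1_plus_square by (auto simp: set_integrable_def)
    then have "(\<integral>\<^sup>+ \<xi>. ennreal (norm (K * inverse (1 + \<xi>\<^sup>2))) \<partial>lborel) < \<infinity>"
      unfolding integrable_iff_bounded by blast
    moreover have "norm (K * inverse (1 + \<xi>\<^sup>2)) = K * inverse (1 + \<xi>\<^sup>2)" for \<xi> :: real
      using K0 by (simp add: abs_mult)
    ultimately show ?thesis by simp
  qed
  finally show ?thesis .
qed

section \<open>Product bumps in several dimensions\<close>

lemma cis_sum: "cis (\<Sum>b\<in>A. f b) = (\<Prod>b\<in>A. cis (f b))"
  by (induction A rule: infinite_finite_induct) (auto simp: cis_mult[symmetric])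

text \<open>The character also factorises over coordinates, and Lebesgue measure is the image of the
  product of one-dimensional Lebesgue measures, so Fubini for finite products applies.\<close>

lemma fourier_prod:
  fixes f :: "'a::euclidean_space \<Rightarrow> real \<Rightarrow> complex"
  assumes "\<And>b \<xi>. b \<in> Basis \<Longrightarrow> integrable lborel (\<lambda>x. cis (- (\<xi> * x)) * f b x)"
    and [measurable]: "\<And>b. b \<in> Basis \<Longrightarrow> f b \<in> borel_measurable borel"
  shows "fourier (\<lambda>x. \<Prod>b\<in>Basis. f b (x \<bullet> b)) \<xi> = (\<Prod>b\<in>Basis. fourier (f b) (\<xi> \<bullet> b))"
proof -
  interpret product_sigma_finite "\<lambda>_::'a. lborel :: real measure" ..
  have [measurable]: "cis \<in> borel_measurable borel"
    by (intro borel_measurable_continuous_onI continuous_intros)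
  have "fourier (\<lambda>x. \<Prod>b\<in>Basis. f b (x \<bullet> b)) \<xi>
    = (LINT x|lborel. (\<Prod>b\<in>Basis. cis (- ((\<xi> \<bullet> b) * (x \<bullet> b))) * f b (x \<bullet> b)))"
  proof -
    have "cis (- (\<xi> \<bullet> x)) = (\<Prod>b\<in>Basis. cis (- ((\<xi> \<bullet> b) * (x \<bullet> b))))" for x
      by (subst euclidean_inner) (simp only: sum_negf[symmetric] cis_sum)
    then show ?thesis unfolding fourier_def by (simp add: prod.distrib)
  qed
  also have "\<dots> = (LINT x|Pi\<^sub>M Basis (\<lambda>_. lborel).
      (\<Prod>b\<in>Basis. cis (- ((\<xi> \<bullet> b) * x b)) * f b (x b)))"
  proof -
    let ?g = "\<lambda>x. \<Prod>b\<in>Basis. cis (- ((\<xi> \<bullet> b) * (x \<bullet> b))) * f b (x \<bullet> b)"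
    let ?s = "\<lambda>y. \<Sum>i\<in>Basis. y i *\<^sub>R (i::'a)"
    have "integral\<^sup>L (distr (Pi\<^sub>M Basis (\<lambda>_. lborel)) borel ?s) ?g
        = (LINT y|Pi\<^sub>M Basis (\<lambda>_. lborel). ?g (?s y))"
      by (rule integral_distr) simp_all
    moreover have "?g (?s y) = (\<Prod>b\<in>Basis. cis (- ((\<xi> \<bullet> b) * y b)) * f b (y b))" for y
      by (intro prod.cong) simp_all
    ultimately show ?thesis unfolding lborel_eq[symmetric] by simp
  qed
  also have "\<dots> = (\<Prod>b\<in>Basis. fourier (f b) (\<xi> \<bullet> b))"
    unfolding fourier_def inner_real_def using assms(1) by (subst product_integral_prod) auto
  finally show ?thesis .
qed

definition box_bump :: "nat \<Rightarrow> real \<Rightarrow> 'a::euclidean_space \<Rightarrow> 'a \<Rightarrow> real" where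
  "box_bump k r a x = (\<Prod>b\<in>Basis. bump k r (a \<bullet> b) (x \<bullet> b))"

lemma box_bump_nonneg: "0 \<le> box_bump k r a x"
  by (simp add: box_bump_def prod_nonneg bump_nonneg)

lemma box_bump_center: "0 < r \<Longrightarrow> 0 < box_bump k r a a"
  by (simp add: box_bump_def bump_def prod_pos)

lemma box_bump_nonzero:
  assumes "0 < r" "0 < k" "box_bump k r a x \<noteq> 0" "b \<in> Basis"
  shows "\<bar>(x - a) \<bullet> b\<bar> < r"
  using assms bump_eq_0[of r k "x \<bullet> b" "a \<bullet> b"]
  by (force simp: box_bump_def inner_diff_left)

lemma continuous_on_box_bump: "continuous_on S (box_bump k r a)"
  unfolding box_bump_def[abs_def] by (intro continuous_intros)

text \<open>Expanding the product yields 1, every single square, and further nonnegative terms. It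
  replaces the isotropic Sobolev weight by one that splits over coordinates.\<close>

lemma one_plus_norm_le_prod: "1 + (norm (\<xi>::'a::euclidean_space))\<^sup>2 \<le> (\<Prod>b\<in>Basis. 1 + (\<xi> \<bullet> b)\<^sup>2)"
proof -
  have "1 + (\<Sum>b\<in>A. (\<xi> \<bullet> b)\<^sup>2) \<le> (\<Prod>b\<in>A. 1 + (\<xi> \<bullet> b)\<^sup>2)" if "finite A" for A :: "'a set"
    using that
  proof induction
    case (insert b A)
    have "1 \<le> (\<Prod>b\<in>A. 1 + (\<xi> \<bullet> b)\<^sup>2)" by (intro prod_ge_1) auto
    then have "(\<xi> \<bullet> b)\<^sup>2 * 1 \<le> (\<xi> \<bullet> b)\<^sup>2 * (\<Prod>b\<in>A. 1 + (\<xi> \<bullet> b)\<^sup>2)" by (intro mult_left_mono) auto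
    with insert show ?case by (simp add: algebra_simps)
  qed simp
  moreover have "(norm \<xi>)\<^sup>2 = (\<Sum>b\<in>Basis. (\<xi> \<bullet> b)\<^sup>2)"
    unfolding power2_norm_eq_inner by (subst euclidean_inner) (simp add: power2_eq_square)
  ultimately show ?thesis by simp
qed

text \<open>The ordinary Fourier integral is itself a valid \<open>plancherel\<close> transform: its
  square integrability follows from the weighted bound, since the weight is at least 1, and
  truncation to large balls changes nothing. Plancherel's theorem is thus bypassed.\<close>

lemma box_bump_in_sobolev:
  fixes a :: "'a::euclidean_space"
  assumes r: "0 < r" and k: "0 < k" and s: "0 \<le> s" "s + 1 \<le> real k"
  shows "(\<lambda>x. A * box_bump k r a x) \<in> sobolev s"
proof -
  let ?f = "\<lambda>x. complex_of_real (A * box_bump k r a x)"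
  let ?b = "\<lambda>b \<xi>. fourier (\<lambda>x. complex_of_real (bump k r (a \<bullet> b) x)) \<xi>"
  have cont: "continuous_on UNIV ?f" by (intro continuous_intros continuous_on_box_bump)
  have supp: "?f x = 0" if "x \<notin> cbox (a - r *\<^sub>R One) (a + r *\<^sub>R One)" for x
  proof (rule ccontr)
    assume "?f x \<noteq> 0"
    then have "\<bar>(x - a) \<bullet> b\<bar> < r" if "b \<in> Basis" for b
      using box_bump_nonzero[OF r k, of a x] that by auto
    then have "x \<in> cbox (a - r *\<^sub>R One) (a + r *\<^sub>R One)"
      by (force simp: mem_box inner_diff_left inner_add_left abs_less_iff)
    with that show False by simp
  qed
  have four: "fourier ?f \<xi> = of_real A * (\<Prod>b\<in>Basis. ?b b (\<xi> \<bullet> b))" for \<xi>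
  proof -
    have "fourier ?f \<xi> = of_real A * fourier (\<lambda>x. \<Prod>b\<in>Basis. complex_of_real (bump k r (a \<bullet> b) (x \<bullet> b))) \<xi>"
      unfolding fourier_def box_bump_def by (simp add: mult.left_commute)
    then show ?thesis
      by (subst (asm) fourier_prod)
         (auto simp: bump_integrable(1)[OF r k]
           intro!: borel_measurable_continuous_onI continuous_intros)
  qed
  have [measurable]: "fourier ?f \<in> borel_measurable borel"
    by (intro borel_measurable_fourier borel_measurable_continuous_onI cont)
  have "(\<lambda>\<xi>. (cmod (g \<xi>))\<^sup>2) \<in> borel_measurable borel" if "g \<in> borel_measurable borel" for g :: "'a \<Rightarrow> complex"
    using that by measurable
  from this[OF \<open>fourier ?f \<in> borel_measurable borel\<close>]
  have gm: "(\<lambda>\<xi>. (cmod (fourier ?f \<xi>))\<^sup>2) \<in> borel_measurable lborel" by (simp only: measurable_lborel2)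
  have [measurable]: "?b b \<in> borel_measurable borel" for b
    by (intro borel_measurable_fourier borel_measurable_continuous_onI continuous_intros)
  let ?w = "\<lambda>\<xi>. ennreal ((1 + (norm \<xi>)\<^sup>2) powr s * (cmod (fourier ?f \<xi>))\<^sup>2)"
  have w: "?w \<xi> \<le> ennreal (A\<^sup>2) * (\<Prod>b\<in>Basis. ennreal ((1 + (\<xi> \<bullet> b)\<^sup>2) powr s * (cmod (?b b (\<xi> \<bullet> b)))\<^sup>2))" for \<xi>
  proof -
    have "(1 + (norm \<xi>)\<^sup>2) powr s \<le> (\<Prod>b\<in>Basis. 1 + (\<xi> \<bullet> b)\<^sup>2) powr s"
      using s one_plus_norm_le_prod by (intro powr_mono2) auto
    also have "\<dots> = (\<Prod>b\<in>Basis. (1 + (\<xi> \<bullet> b)\<^sup>2) powr s)"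
      by (rule prod_powr_distrib)
    finally have "(1 + (norm \<xi>)\<^sup>2) powr s * (cmod (fourier ?f \<xi>))\<^sup>2
       \<le> (\<Prod>b\<in>Basis. (1 + (\<xi> \<bullet> b)\<^sup>2) powr s) * (cmod (fourier ?f \<xi>))\<^sup>2" by (intro mult_right_mono) auto
    also have "\<dots> = A\<^sup>2 * (\<Prod>b\<in>Basis. (1 + (\<xi> \<bullet> b)\<^sup>2) powr s * (cmod (?b b (\<xi> \<bullet> b)))\<^sup>2)"
      unfolding four by (simp add: norm_mult prod_norm[symmetric] power_mult_distrib prod.distrib prod_power_distrib)
    finally show ?thesis
      by (subst prod_ennreal) (auto simp: ennreal_mult[symmetric] prod_nonneg intro!: ennreal_leI)
  qed
  have fin: "(\<integral>\<^sup>+ \<xi>. ?w \<xi> \<partial>lborel) < \<infinity>"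
  proof -
    have "(\<integral>\<^sup>+ \<xi>. ?w \<xi> \<partial>lborel)
      \<le> (\<integral>\<^sup>+ \<xi>. ennreal (A\<^sup>2) * (\<Prod>b\<in>Basis. ennreal ((1 + (\<xi> \<bullet> b)\<^sup>2) powr s * (cmod (?b b (\<xi> \<bullet> b)))\<^sup>2)) \<partial>lborel)"
      by (intro nn_integral_mono w)
    also have "\<dots> = ennreal (A\<^sup>2) * (\<Prod>b\<in>Basis. (\<integral>\<^sup>+ \<xi>. ennreal ((1 + \<xi>\<^sup>2) powr s * (cmod (?b b \<xi>))\<^sup>2) \<partial>lborel))"
      by (subst nn_integral_cmult, measurable, subst nn_integral_lborel_prod[symmetric]) auto
    also have "\<dots> < \<infinity>"
    proof -
      have "(\<Prod>b\<in>Basis. (\<integral>\<^sup>+ \<xi>. ennreal ((1 + \<xi>\<^sup>2) powr s * (cmod (?b b \<xi>))\<^sup>2) \<partial>lborel)) \<noteq> \<infinity>"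
        using bump_fourier_weighted[OF r k s]
        unfolding infinity_ennreal_def ennreal_prod_eq_top less_top[symmetric] by simp
      then show ?thesis
        unfolding infinity_ennreal_def less_top[symmetric] by (simp add: ennreal_mult_eq_top_iff)
    qed
    finally show ?thesis .
  qed
  have "plancherel ?f (fourier ?f)"
    unfolding plancherel_def
  proof (intro conjI)
    have c2: "continuous_on UNIV (\<lambda>x. (cmod (?f x))\<^sup>2)" by (intro continuous_intros continuous_on_box_bump)
    show "square_integrable ?f"
      unfolding square_integrable_def
      using compact_support_integral(1)[OF c2, of "a - r *\<^sub>R One" "a + r *\<^sub>R One"] supp
        borel_measurable_continuous_onI[OF cont] by auto
    have "(\<integral>\<^sup>+ \<xi>. ennreal (norm ((cmod (fourier ?f \<xi>))\<^sup>2)) \<partial>lborel) \<le> (\<integral>\<^sup>+ \<xi>. ?w \<xi> \<partial>lborel)"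
    proof (intro nn_integral_mono ennreal_leI)
      fix \<xi> :: 'a
      have "1 \<le> (1 + (norm \<xi>)\<^sup>2) powr s" using s by (intro ge_one_powr_ge_zero) auto
      then have "1 * (cmod (fourier ?f \<xi>))\<^sup>2 \<le> (1 + (norm \<xi>)\<^sup>2) powr s * (cmod (fourier ?f \<xi>))\<^sup>2"
        by (intro mult_right_mono) auto
      then show "norm ((cmod (fourier ?f \<xi>))\<^sup>2) \<le> (1 + (norm \<xi>)\<^sup>2) powr s * (cmod (fourier ?f \<xi>))\<^sup>2" by simp
    qed
    then have "integrable lborel (\<lambda>\<xi>. (cmod (fourier ?f \<xi>))\<^sup>2)"
      using fin by (intro integrableI_bounded[OF gm]) (rule le_less_trans)
    with \<open>fourier ?f \<in> borel_measurable borel\<close> show "square_integrable (fourier ?f)"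
      unfolding square_integrable_def by (simp only: measurable_lborel2)
    obtain B where B: "\<And>x. x \<in> cbox (a - r *\<^sub>R One) (a + r *\<^sub>R One) \<Longrightarrow> norm x \<le> B"
      using bounded_cbox[of "a - r *\<^sub>R One" "a + r *\<^sub>R One"] unfolding bounded_iff by metis
    \<comment> \<open>Once the ball contains the support the error integral is exactly 0, so the
      required limit is that of an eventually constant function.\<close>
    have "fourier (\<lambda>x. indicator (cball 0 R) x * ?f x) = fourier ?f" if "B \<le> R" for R
    proof -
      have "indicator (cball 0 R) x * ?f x = ?f x" for x
      proof (cases "norm x \<le> R")
        case False
        then have "x \<notin> cbox (a - r *\<^sub>R One) (a + r *\<^sub>R One)" using B[of x] that by linarith
        then have "?f x = 0" by (rule supp)
        then show ?thesis by (simp only: mult_zero_right)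
      qed simp
      then show ?thesis by (simp only:)
    qed
    then show "((\<lambda>R. \<integral>\<^sup>+ \<xi>. ennreal ((cmod (fourier ?f \<xi> - fourier (\<lambda>x. indicator (cball 0 R) x * ?f x) \<xi>))\<^sup>2) \<partial>lborel)
        \<longlongrightarrow> 0) at_top"
      by (intro tendsto_eventually eventually_at_top_linorderI[of B]) simp
  qed
  \<comment> \<open>\<open>sobolev_sq\<close> is an infimum over versions of the transform, so this
    one version bounds it from above.\<close>
  then have "sobolev_sq s (\<lambda>x. A * box_bump k r a x) \<le> (\<integral>\<^sup>+ \<xi>. ?w \<xi> \<partial>lborel)"
    unfolding sobolev_sq_def by (intro INF_lower) simp
  with fin show ?thesis by (simp add: sobolev_def le_less_trans)
qed

section \<open>Integrals of derivatives of compactly supported functions\<close>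

abbreviation cube :: "real \<Rightarrow> 'a::euclidean_space set" where
  "cube L \<equiv> cbox (- L *\<^sub>R One) (L *\<^sub>R One)"

lemma norm_le_imp_mem_cube: "norm (x::'a::euclidean_space) \<le> L \<Longrightarrow> x \<in> cube L"
  using Basis_le_norm[of _ x] by (force simp: mem_box abs_le_iff)

lemma integral_cube_eq_UNIV:
  fixes f :: "'a::euclidean_space \<Rightarrow> real"
  assumes "\<And>x. L < norm x \<Longrightarrow> f x = 0"
  shows "integral (cube L) f = integral UNIV f"
proof -
  have "(if x \<in> cube L then f x else 0) = f x" for x
    using assms[of x] norm_le_imp_mem_cube[of x L] by (cases "norm x \<le> L") simp_all
  then show ?thesis
    using integral_restrict_UNIV[of "cube L" f] by simp
qed

lemma integral_UNIV_translation:
  fixes f :: "'a::euclidean_space \<Rightarrow> real"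
  assumes f: "continuous_on UNIV f" and supp: "\<And>x. K \<le> norm x \<Longrightarrow> f x = 0"
  shows "integral UNIV (\<lambda>x. f (c + x)) = integral UNIV f"
proof -
  define L where "L = max 0 K + norm c"
  have "f x = 0" if "x \<notin> cube L" for x
  proof (rule supp)
    have "L < norm x" using that norm_le_imp_mem_cube not_less by blast
    then show "K \<le> norm x" using norm_ge_zero[of c] unfolding L_def by linarith
  qed
  moreover have "f (c + x) = 0" if "x \<notin> cube L" for x
  proof (rule supp)
    have "L < norm x" using that norm_le_imp_mem_cube not_less by blast
    then show "K \<le> norm (c + x)" using norm_diff_ineq[of x c] unfolding L_def add.commute[of c x] by linarith
  qed
  ultimately have i: "integral\<^sup>L lborel f = integral UNIV f"
      "integral\<^sup>L lborel (\<lambda>x. f (c + x)) = integral UNIV (\<lambda>x. f (c + x))"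
  proof -
    assume 1: "\<And>x. x \<notin> cube L \<Longrightarrow> f x = 0" and 2: "\<And>x. x \<notin> cube L \<Longrightarrow> f (c + x) = 0"
    have c2: "continuous_on UNIV (\<lambda>x. f (c + x))"
      by (rule continuous_on_compose2[OF f]) (auto intro!: continuous_intros)
    show "integral\<^sup>L lborel f = integral UNIV f"
      using compact_support_integral(1)[OF f 1] by (simp add: integral_lborel)
    show "integral\<^sup>L lborel (\<lambda>x. f (c + x)) = integral UNIV (\<lambda>x. f (c + x))"
      using compact_support_integral(1)[OF c2 2] by (simp add: integral_lborel)
  qed
  have "integral\<^sup>L lborel f = integral\<^sup>L (distr lborel borel ((+) c)) f" by (simp add: lborel_distr_plus)
  also have "\<dots> = integral\<^sup>L lborel (\<lambda>x. f (c + x))"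
    by (rule integral_distr) (auto intro: borel_measurable_continuous_onI f)
  finally show ?thesis using i by simp
qed

text \<open>Differentiate the translation invariance of the integral.\<close>

lemma integral_directional_derivative:
  fixes f :: "'a::euclidean_space \<Rightarrow> real"
  assumes der: "\<And>x. (f has_derivative f' x) (at x)"
    and cont: "continuous_on UNIV (\<lambda>x. f' x v)"
    and supp: "\<And>x. K \<le> norm x \<Longrightarrow> f x = 0"
    and L: "K \<le> L"
  shows "integral (cube L) (\<lambda>x. f' x v) = 0"
proof -
  \<comment> \<open>Large enough that every translate of \<open>f\<close> by
    \<open>h *\<^sub>R v\<close> with |h| \<le> 1 is supported in the same cube; \<open>max\<close>
    covers a negative \<open>K\<close>.\<close>
  define R where "R = max 0 K + norm v"
  have cf: "continuous_on UNIV f"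
    using der by (meson has_derivative_continuous continuous_at_imp_continuous_on)
  \<comment> \<open>The inequality is strict because \<open>f\<close> must vanish on a whole open
    neighbourhood for its derivative to be 0.\<close>
  have der0: "f' x v = 0" if "K < norm x" for x
  proof -
    have "open {x. K < norm (x::'a)}" by (intro open_Collect_less continuous_intros)
    then have "((\<lambda>x. 0) has_derivative f' x) (at x)"
      using has_derivative_transform_within_open[OF der] that supp by (metis (mono_tags, lifting) less_imp_le mem_Collect_eq)
    then have "f' x = (\<lambda>h. 0)" by (metis has_derivative_const has_derivative_unique)
    then show ?thesis by simp
  qed
  let ?\<phi> = "\<lambda>h. integral (cube R) (\<lambda>x. f (h *\<^sub>R v + x))"
  have const: "?\<phi> h = integral UNIV f" if "h \<in> {-1..1}" for h
  proof -
    have "f (h *\<^sub>R v + x) = 0" if "R < norm x" for x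
    proof (rule supp)
      have "norm (h *\<^sub>R v) \<le> norm v" using \<open>h \<in> {-1..1}\<close>
        by (simp add: mult_left_le_one_le abs_le_iff)
      moreover have "norm x - norm (h *\<^sub>R v) \<le> norm (h *\<^sub>R v + x)"
        by (metis add.commute norm_diff_ineq)
      ultimately show "K \<le> norm (h *\<^sub>R v + x)" using that by (simp add: R_def)
    qed
    then show ?thesis
      using integral_cube_eq_UNIV[of R "\<lambda>x. f (h *\<^sub>R v + x)"] integral_UNIV_translation[OF cf supp] by simp
  qed
  have "(?\<phi> has_vector_derivative integral (cube R) (\<lambda>x. f' (0 *\<^sub>R v + x) v)) (at 0 within {-1..1})"
  proof (rule leibniz_rule_vector_derivative)
    show "((\<lambda>h. f (h *\<^sub>R v + x)) has_vector_derivative f' (h *\<^sub>R v + x) v) (at h within {-1..1})" for h x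
    proof -
      have "((\<lambda>h. h *\<^sub>R v + x) has_derivative (\<lambda>k. k *\<^sub>R v)) (at h)"
        by (auto intro!: derivative_eq_intros)
      from has_derivative_compose[OF this der] show ?thesis
        unfolding has_vector_derivative_def
        by (simp add: linear_scale[OF has_derivative_linear[OF der]] has_derivative_at_withinI)
    qed
    show "(\<lambda>x. f (h *\<^sub>R v + x)) integrable_on cube R" for h
      by (intro integrable_continuous continuous_on_compose2[OF cf]) (auto intro!: continuous_intros)
    show "continuous_on ({-1..1} \<times> cube R) (\<lambda>(h, x). f' (h *\<^sub>R v + x) v)"
      unfolding split_beta by (intro continuous_on_compose2[OF cont]) (auto intro!: continuous_intros)
  qed auto
  then have "((\<lambda>h::real. integral UNIV f) has_vector_derivative integral (cube R) (\<lambda>x. f' x v)) (at 0 within {-1..1})"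
    using has_vector_derivative_transform[of 0 "{-1..1}" "\<lambda>h. integral UNIV f" ?\<phi>] const by simp
  then have "((\<lambda>h::real. integral UNIV f) has_vector_derivative integral (cube R) (\<lambda>x. f' x v)) (at 0)"
    by (subst (asm) at_within_interior) auto
  then have "integral (cube R) (\<lambda>x. f' x v) = 0"
    using vector_derivative_unique_at has_vector_derivative_const by blast
  moreover have "integral (cube R) (\<lambda>x. f' x v) = integral UNIV (\<lambda>x. f' x v)"
  proof (intro integral_cube_eq_UNIV der0)
    fix x :: 'a
    assume "R < norm x"
    then show "K < norm x" using norm_ge_zero[of v] unfolding R_def by linarith
  qed
  moreover have "integral (cube L) (\<lambda>x. f' x v) = integral UNIV (\<lambda>x. f' x v)"
    using L by (intro integral_cube_eq_UNIV der0) auto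
  ultimately show ?thesis by simp
qed

text \<open>The integrand is the divergence of \<phi>\<rho>u, so each coordinate contributes a
  directional derivative with integral zero. Compact support comes from \<open>u\<close> alone,
  leaving the test function free: 1 will give mass, a velocity component momentum, and a coordinate
  the first moment.\<close>

lemma integral_transport:
  fixes \<rho> \<phi> :: "real^'n \<Rightarrow> real" and u :: "real^'n \<Rightarrow> real^'n"
  assumes \<rho>: "\<And>x. (\<rho> has_derivative (\<lambda>k. R x \<bullet> k)) (at x)" "continuous_on UNIV R"
    and u: "\<And>x i. ((\<lambda>y. u y $ i) has_derivative (\<lambda>k. W i x \<bullet> k)) (at x)" "\<And>i. continuous_on UNIV (W i)"
    and \<phi>: "\<And>x. (\<phi> has_derivative (\<lambda>k. \<Phi> x \<bullet> k)) (at x)" "continuous_on UNIV \<Phi>"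
    and supp: "\<And>x. K \<le> norm x \<Longrightarrow> u x = 0" and L: "K \<le> L"
  shows "integral (cube L) (\<lambda>x. (\<Sum>i\<in>UNIV. R x $ i * u x $ i + \<rho> x * W i x $ i) * \<phi> x + \<rho> x * (u x \<bullet> \<Phi> x)) = 0"
proof -
  have c: "continuous_on UNIV \<rho>" "continuous_on UNIV \<phi>" "continuous_on UNIV (\<lambda>x. u x $ i)" for i
    using \<rho>(1) \<phi>(1) u(1) by (meson has_derivative_continuous continuous_at_imp_continuous_on)+
  have e: "y \<bullet> axis i 1 = y $ i" for y :: "real^'n" and i by (simp add: inner_axis)
  let ?g = "\<lambda>i x. (R x $ i * u x $ i + \<rho> x * W i x $ i) * \<phi> x + \<rho> x * u x $ i * \<Phi> x $ i"
  let ?D = "\<lambda>i x k. ((R x \<bullet> k) * u x $ i + \<rho> x * (W i x \<bullet> k)) * \<phi> x + \<rho> x * u x $ i * (\<Phi> x \<bullet> k)"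
  have "integral (cube L) (?g i) = 0" for i
  proof -
    have "integral (cube L) (\<lambda>x. ?D i x (axis i 1)) = 0"
    proof (rule integral_directional_derivative[OF _ _ _ L])
      show "((\<lambda>x. \<rho> x * u x $ i * \<phi> x) has_derivative ?D i x) (at x)" for x
        by (rule has_derivative_eq_rhs, (rule has_derivative_mult \<rho>(1) u(1) \<phi>(1))+)
           (auto simp: fun_eq_iff algebra_simps)
      show "continuous_on UNIV (\<lambda>x. ?D i x (axis i 1))"
        unfolding e by (intro continuous_intros c \<rho>(2) u(2) \<phi>(2))
      show "\<rho> x * u x $ i * \<phi> x = 0" if "K \<le> norm x" for x using supp[OF that] by simp
    qed
    then show ?thesis by (simp only: e)
  qed
  moreover have "?g i integrable_on cube L" for i
  proof -
    have "continuous_on UNIV (?g i)" by (intro continuous_intros c \<rho>(2) u(2) \<phi>(2))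
    then show ?thesis using integrable_continuous continuous_on_subset by blast
  qed
  ultimately have "integral (cube L) (\<lambda>x. \<Sum>i\<in>UNIV. ?g i x) = 0"
    by (simp add: integral_sum)
  moreover have "(\<Sum>i\<in>UNIV. ?g i x)
      = (\<Sum>i\<in>UNIV. R x $ i * u x $ i + \<rho> x * W i x $ i) * \<phi> x + \<rho> x * (u x \<bullet> \<Phi> x)" for x
    by (simp only: sum.distrib sum_distrib_right[symmetric] inner_vec_def inner_real_def
      sum_distrib_left mult.assoc)
  ultimately show ?thesis by simp
qed

section \<open>Conservation of mass and momentum\<close>

text \<open>Restricting the joint derivative to a time line keeps it one-sided at time 0;
  restricting it to a space slice gives a full derivative, since the slice is the whole
  space.\<close>

lemma C1_classicalE:
  assumes "C1_classical T w"
  obtains wt wx where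
    "continuous_on ({0..<T} \<times> UNIV) (\<lambda>(t, x). wt t x)"
    "continuous_on ({0..<T} \<times> UNIV) (\<lambda>(t, x). wx t x)"
    "\<And>t x. t \<in> {0..<T} \<Longrightarrow> ((\<lambda>r. w r x) has_vector_derivative wt t x) (at t within {0..<T})"
    "\<And>t x. t \<in> {0..<T} \<Longrightarrow> (w t has_derivative (\<lambda>k. wx t x \<bullet> k)) (at x)"
proof -
  obtain wt wx where c: "continuous_on ({0..<T} \<times> UNIV) (\<lambda>(t, x). wt t x)"
      "continuous_on ({0..<T} \<times> UNIV) (\<lambda>(t, x). wx t x)"
    and d: "\<And>t x. t \<in> {0..<T} \<Longrightarrow> ((\<lambda>(r, y). w r y) has_derivative (\<lambda>(h, k). wt t x * h + wx t x \<bullet> k))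
        (at (t, x) within {0..<T} \<times> UNIV)"
    using assms unfolding C1_classical_def by metis
  have "((\<lambda>r. w r x) has_vector_derivative wt t x) (at t within {0..<T})" if t: "t \<in> {0..<T}" for t x
  proof -
    have "((\<lambda>r. (r, x)) has_derivative (\<lambda>h. (h, 0))) (at t within {0..<T})"
      by (auto intro!: derivative_eq_intros)
    moreover have "((\<lambda>(r, y). w r y) has_derivative (\<lambda>(h, k). wt t x * h + wx t x \<bullet> k))
        (at (t, x) within (\<lambda>r. (r, x)) ` {0..<T})"
      by (rule has_derivative_subset[OF d[OF t]]) auto
    ultimately have "((\<lambda>r. w r x) has_derivative (\<lambda>h. wt t x * h)) (at t within {0..<T})"
      using has_derivative_in_compose[of "\<lambda>r. (r, x)" "\<lambda>h. (h, 0)"] by fastforce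
    then show ?thesis by (simp add: has_vector_derivative_def mult.commute)
  qed
  moreover have "(w t has_derivative (\<lambda>k. wx t x \<bullet> k)) (at x)" if t: "t \<in> {0..<T}" for t x
  proof -
    have "((\<lambda>y. (t, y)) has_derivative (\<lambda>k. (0, k))) (at x)"
      by (auto intro!: derivative_eq_intros)
    moreover have "((\<lambda>(r, y). w r y) has_derivative (\<lambda>(h, k). wt t x * h + wx t x \<bullet> k))
        (at (t, x) within range (Pair t))"
      by (rule has_derivative_subset[OF d[OF t]]) (use t in auto)
    ultimately show ?thesis
      using has_derivative_in_compose[of "\<lambda>y. (t, y)" "\<lambda>k. (0, k)"] by fastforce
  qed
  ultimately show thesis using c that by blast
qed

lemma continuous_on_slice:
  "continuous_on ({0..<T} \<times> UNIV) (\<lambda>(t, x). f t x) \<Longrightarrow> t \<in> {0..<T} \<Longrightarrow> continuous_on UNIV (f t)"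
  by (drule continuous_on_compose2[where f = "\<lambda>x. (t, x)" and s = UNIV])
     (auto intro!: continuous_on_Pair continuous_on_const continuous_on_id)

section \<open>Derivatives of vector fields and values of the differential operators\<close>

lemma has_derivative_vec:
  fixes f :: "'a::real_normed_vector \<Rightarrow> real^'n"
  assumes "\<And>i. ((\<lambda>x. f x $ i) has_derivative (\<lambda>k. D i k)) (at a within S)"
  shows "(f has_derivative (\<lambda>k. \<chi> i. D i k)) (at a within S)"
proof -
  have "((\<lambda>x. f x \<bullet> b) has_derivative (\<lambda>k. (\<chi> i. D i k) \<bullet> b)) (at a within S)" if b: "b \<in> Basis" for b
  proof -
    obtain i where "b = axis i 1" using b unfolding Basis_vec_def Basis_real_def by blast
    then show ?thesis using assms[of i] by (simp add: inner_axis)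
  qed
  then show ?thesis by (subst has_derivative_componentwise_within) blast
qed

lemma has_vector_derivative_vec:
  fixes f :: "real \<Rightarrow> real^'n"
  assumes "\<And>i. ((\<lambda>x. f x $ i) has_vector_derivative D i) (at a within S)"
  shows "(f has_vector_derivative (\<chi> i. D i)) (at a within S)"
proof -
  have "(f has_derivative (\<lambda>k. \<chi> i. k *\<^sub>R D i)) (at a within S)"
    by (rule has_derivative_vec) (use assms in \<open>simp add: has_vector_derivative_def\<close>)
  moreover have "(\<lambda>k. \<chi> i. k *\<^sub>R D i) = (\<lambda>k. k *\<^sub>R (\<chi> i. D i))"
    by (simp add: fun_eq_iff vec_eq_iff)
  ultimately show ?thesis unfolding has_vector_derivative_def by simp
qed

lemma gradient_eq: "(f has_derivative D) (at x) \<Longrightarrow> gradient f x $ j = D (axis j 1)"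
  by (simp add: gradient_def frechet_derivative_at[symmetric])

lemma time_deriv_eq:
  assumes "((\<lambda>r. w r x) has_vector_derivative D) (at t within {0..<T})" "t \<in> {0..<T}"
  shows "time_deriv T w t x = D"
proof -
  \<comment> \<open>A second point makes the interval a connected non-singleton, hence
    \<open>t\<close> a limit point, without which the derivative within it would not be
    unique.\<close>
  have "(t + T) / 2 \<in> {0..<T}" "(t + T) / 2 \<noteq> t" using assms(2) by auto
  then have "\<nexists>x. {0..<T} = {x}" using assms(2) by (metis singletonD)
  then have "t islimpt {0..<T}"
    using assms(2) by (intro connected_imp_perfect) auto
  then show ?thesis
    unfolding time_deriv_def using assms(1)
    by (intro vector_derivative_within) (auto simp: trivial_limit_within)
qed

lemma cube_integral_has_vector_derivative:
  fixes f ft :: "real \<Rightarrow> 'a::euclidean_space \<Rightarrow> real"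
  assumes "\<And>t x. t \<in> {0..<T} \<Longrightarrow> ((\<lambda>r. f r x) has_vector_derivative ft t x) (at t within {0..<T})"
    and "\<And>t. t \<in> {0..<T} \<Longrightarrow> continuous_on UNIV (f t)"
    and "continuous_on ({0..<T} \<times> UNIV) (\<lambda>(t, x). ft t x)"
    and "1 < T" "t \<in> {0..1}"
  shows "((\<lambda>t. integral (cube L) (f t)) has_vector_derivative integral (cube L) (ft t)) (at t within {0..1})"
proof -
  have "((\<lambda>t. integral (cube L) (f t)) has_vector_derivative integral (cube L) (ft t)) (at t within {0..<T})"
  proof (rule leibniz_rule_vector_derivative)
    show "f r integrable_on cube L" if "r \<in> {0..<T}" for r
      using assms(2)[OF that] integrable_continuous continuous_on_subset by blast
    show "continuous_on ({0..<T} \<times> cube L) (\<lambda>(t, x). ft t x)"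
      by (rule continuous_on_subset[OF assms(3)]) auto
  qed (use assms in auto)
  then show ?thesis
    by (rule has_vector_derivative_within_subset) (use assms in auto)
qed

lemma constant_on_unit_interval:
  fixes f :: "real \<Rightarrow> real"
  assumes "\<And>t. t \<in> {0..1} \<Longrightarrow> (f has_vector_derivative 0) (at t within {0..1})" "t \<in> {0..1}"
  shows "f t = f 0"
proof -
  have "\<exists>c. \<forall>t\<in>{0..1}. f t = c"
    by (rule has_derivative_zero_constant) (use assms(1) in \<open>auto simp: has_vector_derivative_def\<close>)
  then show ?thesis using assms(2) by (metis atLeastAtMost_iff order_refl zero_le_one)
qed

text \<open>The first moment of the mass grows linearly in time, with rate the conserved momentum, while
  it cannot exceed the conserved mass times the radius of the support.\<close>

lemma momentum_le_mass:
  fixes \<rho> \<rho>t ut P :: "real \<Rightarrow> real^'n \<Rightarrow> real" and u R :: "real \<Rightarrow> real^'n \<Rightarrow> real^'n"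
    and W :: "'n \<Rightarrow> real \<Rightarrow> real^'n \<Rightarrow> real^'n"
  assumes T: "1 < T" and L: "0 \<le> L" "K \<le> L"
    and rt: "\<And>t x. t \<in> {0..<T} \<Longrightarrow> ((\<lambda>r. \<rho> r x) has_vector_derivative \<rho>t t x) (at t within {0..<T})"
    and rx: "\<And>t x. t \<in> {0..<T} \<Longrightarrow> (\<rho> t has_derivative (\<lambda>k. R t x \<bullet> k)) (at x)"
    and ut: "\<And>t x. t \<in> {0..<T} \<Longrightarrow> ((\<lambda>r. u r x $ j) has_vector_derivative ut t x) (at t within {0..<T})"
    and ux: "\<And>t x i. t \<in> {0..<T} \<Longrightarrow> ((\<lambda>x. u t x $ i) has_derivative (\<lambda>k. W i t x \<bullet> k)) (at x)"
    and cont: "continuous_on ({0..<T} \<times> UNIV) (\<lambda>(t, x). \<rho> t x)"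
      "continuous_on ({0..<T} \<times> UNIV) (\<lambda>(t, x). u t x $ j)"
      "continuous_on ({0..<T} \<times> UNIV) (\<lambda>(t, x). \<rho>t t x)"
      "continuous_on ({0..<T} \<times> UNIV) (\<lambda>(t, x). R t x)"
      "continuous_on ({0..<T} \<times> UNIV) (\<lambda>(t, x). ut t x)"
      "\<And>i. continuous_on ({0..<T} \<times> UNIV) (\<lambda>(t, x). W i t x)"
    and P: "\<And>t x. t \<in> {0..<T} \<Longrightarrow> (P t has_derivative P' t x) (at x)"
    and mass: "\<And>t x. t \<in> {0..<T} \<Longrightarrow> \<rho>t t x + (\<Sum>i\<in>UNIV. R t x $ i * u t x $ i + \<rho> t x * W i t x $ i) = 0"
    and momentum: "\<And>t x. t \<in> {0..<T} \<Longrightarrow> \<rho> t x * ut t x + \<rho> t x * (u t x \<bullet> W j t x) + P' t x (axis j 1) = 0"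
    and supp: "\<And>t x. t \<in> {0..1} \<Longrightarrow> K \<le> norm x \<Longrightarrow> u t x = 0 \<and> P t x = p0"
    and pos: "\<And>t x. t \<in> {0..1} \<Longrightarrow> 0 \<le> \<rho> t x"
  shows "integral (cube L) (\<lambda>x. \<rho> 0 x * u 0 x $ j) \<le> 2 * L * integral (cube L) (\<rho> 0)"
proof -
  let ?m = "\<lambda>t. integral (cube L) (\<rho> t)"
  let ?D = "\<lambda>t. integral (cube L) (\<lambda>x. \<rho> t x * x $ j)"
  let ?p = "\<lambda>t. integral (cube L) (\<lambda>x. \<rho> t x * u t x $ j)"
  have int: "f integrable_on cube L" if "continuous_on UNIV f" for f :: "real^'n \<Rightarrow> real"
    using that integrable_continuous continuous_on_subset by blast
  note sl = cont[THEN continuous_on_slice]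
  have cu: "continuous_on UNIV (u t)" if "t \<in> {0..<T}" for t
    using has_derivative_vec[of "u t", OF ux[OF that]]
    by (meson has_derivative_continuous continuous_at_imp_continuous_on)
  have unit: "t \<in> {0..<T}" if "t \<in> {0..1}" for t using that T by auto
  \<comment> \<open>The weak form of the continuity equation: the divergence of the mass flux is
    replaced by minus the time derivative of the density.\<close>
  have transport: "integral (cube L) (\<lambda>x. - \<rho>t t x * \<phi> x + \<rho> t x * (u t x \<bullet> \<Phi> x)) = 0"
    if t: "t \<in> {0..1}" and \<phi>: "\<And>x. (\<phi> has_derivative (\<lambda>k. \<Phi> x \<bullet> k)) (at x)" "continuous_on UNIV \<Phi>"
    for t \<phi> \<Phi>
  proof -
    note t' = unit[OF t]
    have "(\<Sum>i\<in>UNIV. R t x $ i * u t x $ i + \<rho> t x * W i t x $ i) = - \<rho>t t x" for x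
      using mass[OF t', of x] by simp
    moreover have "u t x = 0" if "K \<le> norm x" for x using supp[OF t that] by simp
    ultimately show ?thesis
      using integral_transport[OF rx[OF t'] sl(4)[OF t'] ux[OF t'] sl(6)[OF t'] \<phi>, of K L] L by simp
  qed
  have m: "?m t = ?m 0" if "t \<in> {0..1}" for t
  proof (rule constant_on_unit_interval[OF _ that])
    fix t :: real assume t: "t \<in> {0..1}"
    have "integral (cube L) (\<rho>t t) = 0"
      using transport[OF t, of "\<lambda>_. 1" "\<lambda>_. 0"] by simp
    then show "(?m has_vector_derivative 0) (at t within {0..1})"
      using cube_integral_has_vector_derivative[OF rt sl(1) cont(3) T t, of L] by simp
  qed
  have p: "?p t = ?p 0" if "t \<in> {0..1}" for t
  proof (rule constant_on_unit_interval[OF _ that])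
    fix t :: real assume t: "t \<in> {0..1}"
    note t' = unit[OF t]
    \<comment> \<open>Continuity of this partial derivative of \<open>P\<close> is read off from the
      momentum equation, whose other terms are continuous.\<close>
    have eq: "P' t x (axis j 1) = - (\<rho> t x * ut t x + \<rho> t x * (u t x \<bullet> W j t x))" for x
      using momentum[OF t', of x] by simp
    have P'_cont: "continuous_on UNIV (\<lambda>x. P' t x (axis j 1))"
      unfolding eq by (intro continuous_intros sl cu t')
    have "integral (cube L) (\<lambda>x. P' t x (axis j 1)) = 0"
    \<comment> \<open>\<open>P\<close> tends to no zero value outside the support; subtracting its
      constant value \<open>p0\<close> there gives compact support without changing the
      derivative.\<close>
    proof (rule integral_directional_derivative[where f = "\<lambda>x. P t x - p0" and K = K])
      show "((\<lambda>x. P t x - p0) has_derivative P' t x) (at x)" for x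
        using has_derivative_diff[OF P[OF t'] has_derivative_const] by simp
    qed (use P'_cont supp t L in auto)
    then have "((\<lambda>x. P' t x (axis j 1)) has_integral 0) (cube L)"
      using integrable_integral[OF int[OF P'_cont]] by simp
    \<comment> \<open>\<open>transport\<close> with test function \<open>u t x $ j\<close>. Adding
      it to the integral of the flux derivative turns the nonconservative momentum equation into
      conservation of \<rho>u_j.\<close>
    moreover have "((\<lambda>x. - \<rho>t t x * u t x $ j + \<rho> t x * (u t x \<bullet> W j t x)) has_integral 0) (cube L)"
    proof -
      have "continuous_on UNIV (\<lambda>x. - \<rho>t t x * u t x $ j + \<rho> t x * (u t x \<bullet> W j t x))"
        by (intro continuous_intros sl[OF t'] cu[OF t'])
      from integrable_integral[OF int[OF this]] show ?thesis
        unfolding transport[OF t ux[OF t'] sl(6)[OF t']] .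
    qed
    ultimately have "((\<lambda>x. P' t x (axis j 1) + (- \<rho>t t x * u t x $ j + \<rho> t x * (u t x \<bullet> W j t x)))
        has_integral 0 + 0) (cube L)"
      by (rule has_integral_add)
    moreover have "P' t x (axis j 1) + (- \<rho>t t x * u t x $ j + \<rho> t x * (u t x \<bullet> W j t x))
        = - (\<rho>t t x * u t x $ j + \<rho> t x * ut t x)" for x
      unfolding eq by simp
    ultimately have "((\<lambda>x. - (\<rho>t t x * u t x $ j + \<rho> t x * ut t x)) has_integral 0) (cube L)"
      by (simp only: add_0)
    then have "integral (cube L) (\<lambda>x. \<rho>t t x * u t x $ j + \<rho> t x * ut t x) = 0"
      unfolding has_integral_neg_iff by (simp add: integral_unique)
    moreover have "((\<lambda>t. integral (cube L) (\<lambda>x. \<rho> t x * u t x $ j)) has_vector_derivative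
      integral (cube L) (\<lambda>x. \<rho>t t x * u t x $ j + \<rho> t x * ut t x)) (at t within {0..1})"
    proof (rule cube_integral_has_vector_derivative[OF _ _ _ T t])
      show "((\<lambda>r. \<rho> r x * u r x $ j) has_vector_derivative \<rho>t t x * u t x $ j + \<rho> t x * ut t x)
          (at t within {0..<T})" if "t \<in> {0..<T}" for t x
        using has_vector_derivative_mult[OF rt[OF that] ut[OF that]] by (simp add: add.commute)
      show "continuous_on ({0..<T} \<times> UNIV) (\<lambda>(t, x). \<rho>t t x * u t x $ j + \<rho> t x * ut t x)"
        using cont unfolding split_beta by (intro continuous_on_add continuous_on_mult)
    qed (intro continuous_intros sl)
    ultimately show "(?p has_vector_derivative 0) (at t within {0..1})" by simp
  qed
  have D: "(?D has_vector_derivative ?p t) (at t within {0..1})" if t: "t \<in> {0..1}" for t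
  proof -
    note t' = unit[OF t]
    \<comment> \<open>\<open>transport\<close> with the coordinate function, whose gradient is
      constant.\<close>
    have "integral (cube L) (\<lambda>x. - \<rho>t t x * x $ j + \<rho> t x * (u t x \<bullet> axis j 1)) = 0"
      by (rule transport[OF t])
         (auto simp: inner_axis' intro: bounded_linear_imp_has_derivative bounded_linear_vec_nth)
    then have "integral (cube L) (\<lambda>x. \<rho> t x * u t x $ j - \<rho>t t x * x $ j) = 0"
      by (simp add: inner_axis algebra_simps)
    then have "integral (cube L) (\<lambda>x. \<rho>t t x * x $ j) = ?p t"
    proof -
      have "(\<lambda>x. \<rho> t x * u t x $ j) integrable_on cube L" "(\<lambda>x. \<rho>t t x * x $ j) integrable_on cube L"
        by (intro int continuous_intros sl[OF t'] cu[OF t'])+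
      from integral_diff[OF this] show ?thesis
        using \<open>integral (cube L) (\<lambda>x. \<rho> t x * u t x $ j - \<rho>t t x * x $ j) = 0\<close> by simp
    qed
    moreover have "(?D has_vector_derivative integral (cube L) (\<lambda>x. \<rho>t t x * x $ j)) (at t within {0..1})"
    proof (rule cube_integral_has_vector_derivative[OF _ _ _ T t])
      show "((\<lambda>r. \<rho> r x * x $ j) has_vector_derivative \<rho>t t x * x $ j) (at t within {0..<T})"
        if "t \<in> {0..<T}" for t x
        using has_vector_derivative_mult[OF rt[OF that] has_vector_derivative_const] by simp
      show "continuous_on ({0..<T} \<times> UNIV) (\<lambda>(t, x). \<rho>t t x * x $ j)"
        using cont(3) unfolding split_beta by (intro continuous_intros)
    qed (intro continuous_intros sl)
    ultimately show ?thesis by simp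
  qed
  \<comment> \<open>Constancy of \<open>?D t - t * ?p 0\<close>, evaluated at both ends of the unit
    interval; the redundant factors let the rule match this function.\<close>
  have "?D 1 - 1 * ?p 0 = ?D 0 - 0 * ?p 0"
  proof (rule constant_on_unit_interval)
    fix t :: real assume t: "t \<in> {0..1}"
    have "(?D has_vector_derivative ?p 0) (at t within {0..1})" using D[OF t] p[OF t] by simp
    moreover have "((\<lambda>t. t * ?p 0) has_vector_derivative ?p 0) (at t within {0..1})"
      by (auto simp: has_vector_derivative_def intro!: derivative_eq_intros)
    ultimately show "((\<lambda>t. ?D t - t * ?p 0) has_vector_derivative 0) (at t within {0..1})"
      by (auto dest: has_vector_derivative_diff)
  qed simp
  moreover have "\<bar>?D t\<bar> \<le> L * ?m 0" if t: "t \<in> {0..1}" for t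
  proof -
    note t' = unit[OF t]
    have "norm (?D t) \<le> integral (cube L) (\<lambda>x. L * \<rho> t x)"
    proof (rule integral_norm_bound_integral)
      fix x :: "real^'n" assume "x \<in> cube L"
      then have "\<bar>x \<bullet> b\<bar> \<le> L" if "b \<in> Basis" for b
        using that by (force simp: mem_box abs_le_iff)
      from this[of "axis j 1"] have "\<bar>x $ j\<bar> \<le> L" by (simp add: inner_axis axis_in_Basis_iff)
      then show "norm (\<rho> t x * x $ j) \<le> L * \<rho> t x"
        using pos[OF t, of x] by (simp add: abs_mult mult.commute[of L] mult_left_mono)
    qed (intro int continuous_intros sl t')+
    then show ?thesis using m[OF t] by simp
  qed
  from this[of 0] this[of 1] have "\<bar>?D 0\<bar> \<le> L * ?m 0" "\<bar>?D 1\<bar> \<le> L * ?m 0" by auto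
  ultimately show ?thesis by linarith
qed

section \<open>Large initial momentum\<close>

lemma divergence_scaleR:
  fixes f :: "real^'n \<Rightarrow> real" and u :: "real^'n \<Rightarrow> real^'n"
  assumes f: "(f has_derivative (\<lambda>k. R \<bullet> k)) (at x)"
    and u: "\<And>i. ((\<lambda>y. u y $ i) has_derivative (\<lambda>k. W i \<bullet> k)) (at x)"
  shows "divergence (\<lambda>y. f y *\<^sub>R u y) x = (\<Sum>i\<in>UNIV. R $ i * u x $ i + f x * W i $ i)"
proof -
  have "((\<lambda>y. f y *\<^sub>R u y) has_derivative (\<lambda>k. \<chi> i. f x * (W i \<bullet> k) + (R \<bullet> k) * u x $ i)) (at x)"
    by (rule has_derivative_vec) (simp add: has_derivative_mult[OF f u])
  from frechet_derivative_at[OF this, symmetric] show ?thesis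
    by (simp add: divergence_def inner_axis add.commute)
qed

lemma pert_eq:
  "pert (Velocity i) d = (\<lambda>x. vel d x $ i)" "pert (Flux i) d = (\<lambda>x. flux d x $ i)" "pert Stress d = stress d"
  by (simp_all add: fun_eq_iff)

text \<open>Mere existence suffices, because the momentum equation later identifies the one partial
  derivative that is integrated.\<close>

lemma pressure_has_derivative:
  fixes d :: "'n::finite fields"
  assumes "kappa c \<noteq> 0" "temp d x \<noteq> 0"
    and "(rho d has_derivative R) (at x)" "(temp d has_derivative \<Theta>) (at x)"
      "(flux d has_derivative Q) (at x)" "(stress d has_derivative S) (at x)"
  shows "\<exists>D. (pressure c d has_derivative D) (at x)"
proof -
  have "((\<lambda>x. flux d x \<bullet> flux d x) has_derivative (\<lambda>h. flux d x \<bullet> Q h + Q h \<bullet> flux d x)) (at x)"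
    by (intro has_derivative_inner assms)
  then show ?thesis
    unfolding pressure_def[abs_def] power2_norm_eq_inner unfolding power2_eq_square
    by - (rule exI, (rule derivative_intros assms | assumption | (simp add: assms(1,2); fail))+)
qed

text \<open>Instantiates \<open>momentum_le_mass\<close> with the flux
  \<open>pressure - stress\<close>, which absorbs the right-hand side of the momentum equation.
  Outside the support it has the equilibrium value \<open>rgas c\<close>.\<close>

lemma smooth_solution_momentum_le_mass:
  fixes U :: "real \<Rightarrow> 'n::finite fields"
  assumes sol: "smooth_solution c s \<delta> d T U" and T: "1 < T" and kappa: "kappa c > 0"
    and K: "0 \<le> K" "\<And>t. t \<in> {0..1} \<Longrightarrow> supported_in K (U t)"
  shows "integral (cube K) (\<lambda>x. rho d x * vel d x $ j) \<le> 2 * K * integral (cube K) (rho d)"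
proof -
  have "\<forall>k. \<exists>wt wx. continuous_on ({0..<T} \<times> UNIV) (\<lambda>(t, x). wt t x) \<and>
      continuous_on ({0..<T} \<times> UNIV) (\<lambda>(t, x). wx t x) \<and>
      (\<forall>t\<in>{0..<T}. \<forall>x. ((\<lambda>r. pert k (U r) x) has_vector_derivative wt t x) (at t within {0..<T}) \<and>
        (pert k (U t) has_derivative (\<lambda>h. wx t x \<bullet> h)) (at x))"
  proof
    fix k
    have "C1_classical T (\<lambda>t. pert k (U t))" using sol by (simp add: smooth_solution_def)
    then show "\<exists>wt wx. continuous_on ({0..<T} \<times> UNIV) (\<lambda>(t, x). wt t x) \<and>
      continuous_on ({0..<T} \<times> UNIV) (\<lambda>(t, x). wx t x) \<and>
      (\<forall>t\<in>{0..<T}. \<forall>x. ((\<lambda>r. pert k (U r) x) has_vector_derivative wt t x) (at t within {0..<T}) \<and>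
        (pert k (U t) has_derivative (\<lambda>h. wx t x \<bullet> h)) (at x))"
      by (rule C1_classicalE) blast
  qed
  then obtain wt wx where ct: "\<And>k. continuous_on ({0..<T} \<times> UNIV) (\<lambda>(t, x). wt k t x)"
    and cx: "\<And>k. continuous_on ({0..<T} \<times> UNIV) (\<lambda>(t, x). wx k t x)"
    and dt: "\<And>k t x. t \<in> {0..<T} \<Longrightarrow> ((\<lambda>r. pert k (U r) x) has_vector_derivative wt k t x) (at t within {0..<T})"
    and dx: "\<And>k t x. t \<in> {0..<T} \<Longrightarrow> (pert k (U t) has_derivative (\<lambda>h. wx k t x \<bullet> h)) (at x)"
    by metis
  have cp: "continuous_on ({0..<T} \<times> UNIV) (\<lambda>(t, x). pert k (U t) x)" for k
  proof -
    have "C1_classical T (\<lambda>t. pert k (U t))" using sol by (simp add: smooth_solution_def)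
    then have "\<And>z. z \<in> {0..<T} \<times> UNIV \<Longrightarrow> (\<lambda>(t, x). pert k (U t) x) differentiable (at z within {0..<T} \<times> UNIV)"
      unfolding C1_classical_def differentiable_def by fast
    then show ?thesis by (simp add: differentiable_imp_continuous_on differentiable_on_def)
  qed
  have rt: "((\<lambda>r. rho (U r) x) has_vector_derivative wt Density t x) (at t within {0..<T})" if "t \<in> {0..<T}" for t x
    using has_vector_derivative_add[OF dt[OF that, of Density x] has_vector_derivative_const[of 1]] by simp
  have rx: "(rho (U t) has_derivative (\<lambda>h. wx Density t x \<bullet> h)) (at x)" if "t \<in> {0..<T}" for t x
    using has_derivative_add[OF dx[OF that, of Density x] has_derivative_const[of 1]] by simp
  have tx: "(temp (U t) has_derivative (\<lambda>h. wx Temperature t x \<bullet> h)) (at x)" if "t \<in> {0..<T}" for t x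
    using has_derivative_add[OF dx[OF that, of Temperature x] has_derivative_const[of 1]] by simp
  have ut: "((\<lambda>r. vel (U r) x $ i) has_vector_derivative wt (Velocity i) t x) (at t within {0..<T})"
    if "t \<in> {0..<T}" for t x i using dt[OF that, of "Velocity i" x] by simp
  have ux: "((\<lambda>x. vel (U t) x $ i) has_derivative (\<lambda>h. wx (Velocity i) t x \<bullet> h)) (at x)"
    if "t \<in> {0..<T}" for t x i using dx[OF that, of "Velocity i" x] unfolding pert_eq .
  have qx: "(flux (U t) has_derivative (\<lambda>h. \<chi> i. wx (Flux i) t x \<bullet> h)) (at x)"
    if "t \<in> {0..<T}" for t x
    by (rule has_derivative_vec) (use dx[OF that, of "Flux _" x] in \<open>simp add: pert_eq\<close>)
  have sx: "(stress (U t) has_derivative (\<lambda>h. wx Stress t x \<bullet> h)) (at x)" if "t \<in> {0..<T}" for t x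
    using dx[OF that, of Stress x] unfolding pert_eq .
  obtain m where m: "m > 0" "\<And>t x. t \<in> {0..<T} \<Longrightarrow> m \<le> rho (U t) x \<and> m \<le> temp (U t) x"
    using sol unfolding smooth_solution_def by blast
  have "\<exists>D. (pressure c (U t) has_derivative D) (at x)" if "t \<in> {0..<T}" for t x
    by (rule pressure_has_derivative[OF _ _ rx[OF that] tx[OF that] qx[OF that] sx[OF that]])
       (use kappa m(1) m(2)[OF that, of x] in auto)
  then obtain p' where p': "\<And>t x. t \<in> {0..<T} \<Longrightarrow> (pressure c (U t) has_derivative p' t x) (at x)"
    by metis
  have sys: "solves_system c T U" and U0: "U 0 = d" using sol by (auto simp: smooth_solution_def)
  have "integral (cube K) (\<lambda>x. rho (U 0) x * vel (U 0) x $ j) \<le> 2 * K * integral (cube K) (rho (U 0))"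
  proof (rule momentum_le_mass[OF T K(1) order_refl rt rx ut ux])
    show "continuous_on ({0..<T} \<times> UNIV) (\<lambda>(t, x). rho (U t) x)"
      using continuous_on_add[OF cp[of Density] continuous_on_const[of _ 1]] by (simp add: split_beta)
    show "continuous_on ({0..<T} \<times> UNIV) (\<lambda>(t, x). vel (U t) x $ j)"
      using cp[of "Velocity j"] by simp
    show "((\<lambda>x. pressure c (U t) x - stress (U t) x) has_derivative (\<lambda>h. p' t x h - wx Stress t x \<bullet> h)) (at x)"
      if "t \<in> {0..<T}" for t x by (rule has_derivative_diff[OF p'[OF that] sx[OF that]])
    fix t x assume t: "t \<in> {0..<T}"
    have mass: "time_deriv T (\<lambda>r. rho (U r)) t x + divergence (\<lambda>y. rho (U t) y *\<^sub>R vel (U t) y) x = 0"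
      and mom: "rho (U t) x *\<^sub>R time_deriv T (\<lambda>r. vel (U r)) t x + rho (U t) x *\<^sub>R advect (vel (U t)) (vel (U t)) x
        + gradient (pressure c (U t)) x = gradient (stress (U t)) x"
      using sys t unfolding solves_system_def Let_def by blast+
    show "wt Density t x + (\<Sum>i\<in>UNIV. wx Density t x $ i * vel (U t) x $ i + rho (U t) x * wx (Velocity i) t x $ i) = 0"
      using mass unfolding divergence_scaleR[OF rx[OF t] ux[OF t]] time_deriv_eq[of "\<lambda>r. rho (U r)", OF rt[OF t] t] .
    have "time_deriv T (\<lambda>r. vel (U r)) t x = (\<chi> i. wt (Velocity i) t x)"
      by (rule time_deriv_eq[OF has_vector_derivative_vec t]) (rule ut[OF t])
    moreover have "advect (vel (U t)) (vel (U t)) x = (\<chi> i. wx (Velocity i) t x \<bullet> vel (U t) x)"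
      unfolding advect_def using frechet_derivative_at[OF has_derivative_vec[OF ux[OF t]]] by metis
    ultimately have "rho (U t) x * wt (Velocity j) t x + rho (U t) x * (wx (Velocity j) t x \<bullet> vel (U t) x)
        + p' t x (axis j 1) = wx Stress t x \<bullet> axis j 1"
      using arg_cong[OF mom, of "\<lambda>v. v $ j"]
      by (simp add: gradient_eq[OF p'[OF t]] gradient_eq[OF sx[OF t]])
    then show "rho (U t) x * wt (Velocity j) t x + rho (U t) x * (vel (U t) x \<bullet> wx (Velocity j) t x)
        + (p' t x (axis j 1) - wx Stress t x \<bullet> axis j 1) = 0"
      by (simp add: inner_commute)
  next
    fix t x assume t: "t \<in> {0..1::real}"
    then show "0 \<le> rho (U t) x" using m(1) m(2)[of t x] T by force
    assume "K \<le> norm x"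
    then have z: "pert k (U t) x = 0" for k using K(2)[OF t] by (auto simp: supported_in_def)
    have "vel (U t) x = 0" "flux (U t) x = 0" using z[of "Velocity _"] z[of "Flux _"] by (auto simp: vec_eq_iff)
    moreover have "rho (U t) x = 1" "temp (U t) x = 1" "stress (U t) x = 0"
      using z[of Density] z[of Temperature] z[of Stress] by auto
    ultimately show "vel (U t) x = 0 \<and> pressure c (U t) x - stress (U t) x = rgas c"
      by (simp add: pressure_def)
  qed (use ct cx in auto)
  then show ?thesis unfolding U0 .
qed

section \<open>Positivity of integrals and location of the bump\<close>

lemma compact_support_integral_pos:
  fixes f :: "'a::euclidean_space \<Rightarrow> real"
  assumes f: "continuous_on UNIV f" "\<And>x. 0 \<le> f x" "\<And>x. L \<le> norm x \<Longrightarrow> f x = 0" "0 < f a"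
  shows "integrable lborel f" "0 < integral (cube L) f" "0 < integral\<^sup>L lborel f"
proof -
  have supp: "f x = 0" if "x \<notin> cube L" for x
    using f(3) norm_le_imp_mem_cube[of x L] that by (meson linear)
  have a: "norm a < L" using f(3)[of a] f(4) by force
  have L: "0 < L" using a norm_ge_zero[of a] by linarith
  have ne: "box (- L *\<^sub>R One) (L *\<^sub>R One) \<noteq> ({} :: 'a set)" using L by (simp add: box_ne_empty)
  have c: "continuous_on (cube L) f" using f(1) continuous_on_subset by blast
  have "integral (cube L) f \<noteq> 0"
    using integral_cbox_eq_0_iff[OF c ne f(2)] norm_le_imp_mem_cube[of a L] a f(4) by force
  moreover have "0 \<le> integral (cube L) f" by (rule integral_nonneg) (use c f(2) in \<open>auto intro: integrable_continuous\<close>)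
  ultimately show "0 < integral (cube L) f" by simp
  then show "integrable lborel f" "0 < integral\<^sup>L lborel f"
    using compact_support_integral[OF f(1) supp] by simp_all
qed

text \<open>With n = \<open>CARD('n)\<close>, the centre has norm M/2 and the half-width is M/(4n),
  so the l1 norm of the offset is at most M/4. Hence \<open>x\<close> has norm at most 3M/4, and its
  coordinate \<open>j\<close> exceeds M/4.\<close>

lemma bump_support:
  fixes x :: "real^'n"
  assumes M: "0 < M" and k: "0 < k"
    and nz: "box_bump k (M / (4 * CARD('n))) ((M / 2) *\<^sub>R axis j 1) x \<noteq> 0"
  shows "norm x < M" "0 < x $ j"
proof -
  define r where "r = M / (4 * CARD('n))"
  let ?a = "(M / 2) *\<^sub>R axis j 1 :: real^'n"
  have n: "1 \<le> real CARD('n)" by (simp add: Suc_leI)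
  have r: "0 < r" "r * CARD('n) = M / 4" "r \<le> M / 4" using M n by (simp_all add: r_def field_simps)
  have b: "\<bar>(x - ?a) \<bullet> b\<bar> < r" if "b \<in> Basis" for b
    using box_bump_nonzero[OF r(1) k nz[folded r_def] that] .
  have "norm (x - ?a) \<le> (\<Sum>b\<in>Basis. \<bar>(x - ?a) \<bullet> b\<bar>)" by (rule norm_le_l1)
  also have "\<dots> \<le> (\<Sum>b\<in>(Basis::(real^'n) set). r)" by (intro sum_mono less_imp_le b)
  also have "\<dots> = M / 4" using r(2) by (simp add: mult.commute)
  finally have "norm x \<le> norm ?a + M / 4" using norm_triangle_sub[of x ?a] by simp
  then show "norm x < M" using M by (simp add: norm_axis_1)
  have "\<bar>(x - ?a) \<bullet> axis j 1\<bar> < r" by (rule b) simp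
  then show "0 < x $ j" using r(3) M by (simp add: inner_axis abs_less_iff)
qed

theorem theorem1p2:
  fixes c :: coeffs and s :: real
  assumes dim: "CARD('n::finite) = 2 \<or> CARD('n) = 3"
    and pos: "tau1 c > 0" "tau3 c > 0" "kappa c > 0" "lam c > 0" "cv c > 0" "rgas c > 0"
    and s: "s > real CARD('n) / 2 + 1"
    and gamma: "1 < adiabatic_index c" "adiabatic_index c < 5 / 3"
  shows "\<exists>\<delta>\<^sub>0>0. \<forall>\<delta>. 0 < \<delta> \<and> \<delta> \<le> \<delta>\<^sub>0 \<longrightarrow>
    (\<forall>\<sigma>>0. (\<forall>d :: 'n fields. admissible_data s \<delta> d \<longrightarrow> propagates_with_speed c s \<delta> \<sigma> d) \<longrightarrow>
      (\<exists>M\<^sub>0>0. \<forall>M\<ge>M\<^sub>0. \<forall>d :: 'n fields.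
        admissible_data s \<delta> d \<and> supported_in M d \<and>
        (\<forall>u\<^sub>0. admissible_data s \<delta> (d\<lparr>vel := u\<^sub>0\<rparr>) \<and> supported_in M (d\<lparr>vel := u\<^sub>0\<rparr>) \<longrightarrow>
              locally_solvable c s \<delta> (d\<lparr>vel := u\<^sub>0\<rparr>)) \<longrightarrow>
        (\<exists>u\<^sub>0. let d\<^sub>0 = d\<lparr>vel := u\<^sub>0\<rparr>; \<gamma> = adiabatic_index c; \<rho>max = (SUP x. rho d\<^sub>0 x) in
          admissible_data s \<delta> d\<^sub>0 \<and> supported_in M d\<^sub>0 \<and> G_fun c d\<^sub>0 > 0 \<and>
          F_fun d\<^sub>0 > max (128 * \<sigma> * \<rho>max / (3 * (5 - 3 * \<gamma>)))
                         (8 * sqrt (pi * \<rho>max) / sqrt (3 * (5 - 3 * \<gamma>))) * M ^ 4 \<and>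
          0 < lifespan c s \<delta> d\<^sub>0 \<and> lifespan c s \<delta> d\<^sub>0 < \<infinity>)))"
\<comment> \<open>The witnesses are \<open>\<delta>\<^sub>0 = 1\<close> and
  \<open>M\<^sub>0 = 1\<close>. The latter supplies \<open>0 < M\<close>, required to fit a bump
  into the ball and to invoke the propagation speed.\<close>
proof (rule exI[of _ 1], intro conjI allI impI, simp, rule exI[of _ 1], intro conjI allI impI, simp)
  fix \<delta> \<sigma> M :: real and d :: "'n fields"
  assume \<sigma>: "0 < \<sigma>" and M: "1 \<le> M"
    and speed: "\<forall>d :: 'n fields. admissible_data s \<delta> d \<longrightarrow> propagates_with_speed c s \<delta> \<sigma> d"
    and hyp: "admissible_data s \<delta> d \<and> supported_in M d \<and>
        (\<forall>u\<^sub>0. admissible_data s \<delta> (d\<lparr>vel := u\<^sub>0\<rparr>) \<and> supported_in M (d\<lparr>vel := u\<^sub>0\<rparr>) \<longrightarrow>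
              locally_solvable c s \<delta> (d\<lparr>vel := u\<^sub>0\<rparr>))"
  \<comment> \<open>Fixes an arbitrary coordinate direction for the velocity.\<close>
  obtain j :: 'n where True by simp
  have s0: "0 \<le> s" using s of_nat_0_le_iff[of "CARD('n)", where 'a=real] by linarith
  define k where "k = nat \<lceil>s + 1\<rceil>"
  have k: "0 < k" "s + 1 \<le> real k" 
    using s0 of_nat_ceiling[of "s + 1"] by (simp_all add: k_def)
  define r where "r = M / (4 * CARD('n))"
  define a :: "real^'n" where "a = (M / 2) *\<^sub>R axis j 1"
  define \<psi> where "\<psi> = box_bump k r a"
  have r: "0 < r" using M by (simp add: r_def)
  have \<psi>_cont: "continuous_on UNIV \<psi>" unfolding \<psi>_def by (rule continuous_on_box_bump)
  have \<psi>_nonneg: "0 \<le> \<psi> x" for x by (simp add: \<psi>_def box_bump_nonneg)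
  have \<psi>_a: "0 < \<psi> a" unfolding \<psi>_def by (rule box_bump_center[OF r])
  have \<psi>_supp: "norm x < M \<and> 0 < x $ j" if "\<psi> x \<noteq> 0" for x
    using bump_support[of M k j x] that M k(1) unfolding \<psi>_def r_def a_def by auto
  have \<psi>_sob: "(\<lambda>x. A * \<psi> x) \<in> sobolev s" for A
    unfolding \<psi>_def by (rule box_bump_in_sobolev[OF r k(1) s0 k(2)])

  have adm: "admissible_data s \<delta> d" and supp: "supported_in M d" using hyp by auto
  have cont: "continuous_on UNIV (pert k d)" for k using adm by (simp add: admissible_data_def)
  obtain m where m: "0 < m" "\<And>x. m \<le> rho d x" "\<And>x. m \<le> temp d x" using adm by (auto simp: admissible_data_def)
  have rho_pos: "0 < rho d x" for x using m(1) m(2)[of x] by linarith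
  have temp_pos: "0 < temp d x" for x using m(1) m(3)[of x] by linarith
  have rho_cont: "continuous_on UNIV (rho d)"
    using continuous_on_add[OF cont[of Density] continuous_on_const[of _ 1]] by simp
  have temp_cont: "continuous_on UNIV (temp d)"
    using continuous_on_add[OF cont[of Temperature] continuous_on_const[of _ 1]] by simp
  have stress_cont: "continuous_on UNIV (stress d)" using cont[of Stress] by (simp add: pert_eq)
  have flux_cont: "continuous_on UNIV (flux d)"
    using cont[of "Flux _"] continuous_on_componentwise[of UNIV "flux d"]
    by (auto simp: pert_eq Basis_vec_def inner_axis)

  \<comment> \<open>The energy excess without its kinetic part; it does not depend on the velocity,
    hence not on the amplitude to be chosen.\<close>
  define e where "e x = rho d x * internal_energy c d x - cv c" for x
  have e_cont: "continuous_on UNIV e"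
    unfolding e_def[abs_def] internal_energy_def
    by (intro continuous_intros rho_cont temp_cont stress_cont flux_cont)
       (use pos rho_pos temp_pos in \<open>auto simp: less_le\<close>)
  have e_supp: "e x = 0" if "M \<le> norm x" for x
  proof -
    have z: "pert k d x = 0" for k using supp that by (auto simp: supported_in_def)
    have "flux d x = 0" using z[of "Flux _"] by (auto simp: vec_eq_iff)
    then show ?thesis using z[of Density] z[of Temperature] z[of Stress]
      by (simp add: e_def internal_energy_def)
  qed
  have e_cube: "e x = 0" if "x \<notin> cube M" for x
    using e_supp norm_le_imp_mem_cube[of x M] that by (cases "norm x \<le> M") auto
  have e_int: "integrable lborel e"
    by (rule compact_support_integral(1)[OF e_cont e_cube])

  \<comment> \<open>The support radius at time 1, valid for all earlier times.\<close>
  define K where "K = M + \<sigma>"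
  have K: "0 \<le> K" "M \<le> K" using M \<sigma> by (simp_all add: K_def)
  \<comment> \<open>For amplitude \<open>A\<close>, the momentum, \<open>F_fun\<close> and the
    kinetic energy are \<open>A * I0\<close>, \<open>A * I1\<close> and
    \<open>A\<^sup>2 / 2 * I2\<close>. All three integrals are positive.\<close>
  define I0 where "I0 = integral (cube K) (\<lambda>x. rho d x * \<psi> x)"
  define I1 where "I1 = (LINT x|lborel. rho d x * \<psi> x * x $ j)"
  define I2 where "I2 = (LINT x|lborel. rho d x * (\<psi> x)\<^sup>2)"
  have I0: "0 < I0" unfolding I0_def
  proof (rule compact_support_integral_pos(2)[where a = a])
    show "continuous_on UNIV (\<lambda>x. rho d x * \<psi> x)" by (intro continuous_intros rho_cont \<psi>_cont)
    show "0 \<le> rho d x * \<psi> x" for x using \<psi>_nonneg[of x] rho_pos[of x] by simp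
    show "rho d x * \<psi> x = 0" if "K \<le> norm x" for x using \<psi>_supp[of x] that K by auto
    show "0 < rho d a * \<psi> a" using \<psi>_a rho_pos[of a] by simp
  qed
  have I1: "0 < I1" unfolding I1_def
  proof (rule compact_support_integral_pos(3)[where a = a and L = M])
    show "continuous_on UNIV (\<lambda>x. rho d x * \<psi> x * x $ j)" by (intro continuous_intros rho_cont \<psi>_cont)
    show "0 \<le> rho d x * \<psi> x * x $ j" for x
      using \<psi>_supp[of x] \<psi>_nonneg[of x] rho_pos[of x] by (cases "\<psi> x = 0") auto
    show "rho d x * \<psi> x * x $ j = 0" if "M \<le> norm x" for x using \<psi>_supp[of x] that by auto
    show "0 < rho d a * \<psi> a * a $ j" using \<psi>_a \<psi>_supp[of a] rho_pos[of a] by simp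
  qed
  have I2: "0 < I2" "integrable lborel (\<lambda>x. rho d x * (\<psi> x)\<^sup>2)"
  proof -
    have c: "continuous_on UNIV (\<lambda>x. rho d x * (\<psi> x)\<^sup>2)" by (intro continuous_intros rho_cont \<psi>_cont)
    have p: "0 \<le> rho d x * (\<psi> x)\<^sup>2" for x using rho_pos[of x] by simp
    have z: "rho d x * (\<psi> x)\<^sup>2 = 0" if "M \<le> norm x" for x using \<psi>_supp[of x] that by auto
    have q: "0 < rho d a * (\<psi> a)\<^sup>2" using \<psi>_a rho_pos[of a] by simp
    show "0 < I2" "integrable lborel (\<lambda>x. rho d x * (\<psi> x)\<^sup>2)"
      unfolding I2_def using compact_support_integral_pos[OF c p z q] by auto
  qed

  \<comment> \<open>The bump sits where \<open>x $ j > 0\<close>, so that \<open>F(0)\<close> is positive along with the momentum.\<close>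
  define u where "u A x = (A * \<psi> x) *\<^sub>R (axis j 1 :: real^'n)" for A x
  define B where "B = max (128 * \<sigma> * (SUP x. rho d x) / (3 * (5 - 3 * adiabatic_index c)))
    (8 * sqrt (pi * (SUP x. rho d x)) / sqrt (3 * (5 - 3 * adiabatic_index c))) * M ^ 4"
  define m0 where "m0 = 2 * K * integral (cube K) (rho d)"
  \<comment> \<open>One summand per demand: \<open>F_fun\<close> above \<open>B\<close>, positive
    \<open>G_fun\<close>, and momentum above the bound \<open>m0\<close>. The 1 makes each estimate
    strict and gives \<open>A \<le> A\<^sup>2\<close>, so that the linear choice also controls the
    quadratic term in \<open>G_fun\<close>.\<close>
  define A where "A = 1 + \<bar>B\<bar> / I1 + 2 * \<bar>integral\<^sup>L lborel e\<bar> / I2 + \<bar>m0\<bar> / I0"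
  have nn: "0 \<le> \<bar>B\<bar> / I1" "0 \<le> 2 * \<bar>integral\<^sup>L lborel e\<bar> / I2" "0 \<le> \<bar>m0\<bar> / I0"
    using I0 I1 I2(1) by simp_all
  have A1: "1 \<le> A" using nn by (simp add: A_def)
  have AB: "B < A * I1"
  proof -
    have "\<bar>B\<bar> / I1 < A" using nn by (simp add: A_def)
    then show ?thesis using I1 by (simp add: field_simps)
  qed
  have Am: "m0 < A * I0"
  proof -
    have "\<bar>m0\<bar> / I0 < A" using nn by (simp add: A_def)
    then show ?thesis using I0 by (simp add: field_simps)
  qed
  have AG: "0 < integral\<^sup>L lborel e + A\<^sup>2 / 2 * I2"
  proof -
    have "2 * \<bar>integral\<^sup>L lborel e\<bar> / I2 < A" using nn by (simp add: A_def)
    moreover have "A \<le> A\<^sup>2" using A1 by (simp add: power2_eq_square)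
    ultimately have "2 * \<bar>integral\<^sup>L lborel e\<bar> / I2 < A\<^sup>2" by simp
    then show ?thesis using I2(1) by (simp add: field_simps)
  qed

  let ?d = "d\<lparr>vel := u A\<rparr>"
  have pert_vel: "pert (Velocity i) ?d = (\<lambda>x. (if i = j then A else 0) * \<psi> x)" for i
    by (auto simp: fun_eq_iff u_def axis_def)
  have pert_other: "pert l ?d = pert l d" if "\<And>i. l \<noteq> Velocity i" for l
    using that by (cases l) (auto simp: fun_eq_iff)
  have adm': "admissible_data s \<delta> ?d"
    unfolding admissible_data_def
  proof (intro conjI allI)
    fix l
    have "pert l ?d \<in> sobolev s \<and> continuous_on UNIV (pert l ?d)"
    proof (cases "\<exists>i. l = Velocity i")
      case True
      then show ?thesis using \<psi>_sob by (auto simp only: pert_vel intro!: continuous_intros \<psi>_cont)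
    next
      case False
      then show ?thesis using adm pert_other[of l] by (auto simp: admissible_data_def)
    qed
    then show "pert l ?d \<in> sobolev s" "continuous_on UNIV (pert l ?d)" by auto
  qed (use adm in \<open>auto simp: admissible_data_def\<close>)
  have supp': "supported_in M ?d"
    unfolding supported_in_def
  proof (intro allI impI)
    fix l x assume x: "M \<le> norm (x :: real^'n)"
    show "pert l ?d x = 0"
    proof (cases "\<exists>i. l = Velocity i")
      case True
      then obtain i where "l = Velocity i" ..
      moreover have "\<psi> x = 0" using \<psi>_supp[of x] x by force
      ultimately show ?thesis by (simp only: pert_vel mult_zero_right)
    next
      case False
      then show ?thesis using supp x pert_other[of l] by (auto simp: supported_in_def)
    qed
  qed
  have F: "F_fun ?d = A * I1"
  proof -
    have "x \<bullet> (rho ?d x *\<^sub>R vel ?d x) = A * (rho d x * \<psi> x * x $ j)" for x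
      by (simp add: u_def inner_axis)
    then show ?thesis by (simp only: F_fun_def I1_def integral_mult_right_zero)
  qed
  have G: "G_fun c ?d = integral\<^sup>L lborel e + A\<^sup>2 / 2 * I2"
  proof -
    have "total_energy c ?d x - cv c = e x + A\<^sup>2 / 2 * (rho d x * (\<psi> x)\<^sup>2)" for x
      by (simp add: total_energy_def e_def internal_energy_def u_def norm_axis_1 power_mult_distrib algebra_simps)
    then show ?thesis
      by (simp only: G_fun_def I2_def integral_mult_right_zero
        Bochner_Integration.integral_add[OF e_int integrable_mult_right[OF I2(2)]])
  qed
  \<comment> \<open>Stated for every solution with these data, since \<open>lifespan\<close> is a
    supremum over all of them.\<close>
  have short: "T \<le> 1" if sol: "smooth_solution c s \<delta> ?d T U" for T U
  proof (rule ccontr)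
    assume "\<not> T \<le> 1"
    then have T: "1 < T" by simp
    have "supported_in K (U t)" if t: "t \<in> {0..1}" for t
    proof -
      have "supported_in (M + \<sigma> * t) (U t)"
        using speed adm' supp' sol t T M unfolding propagates_with_speed_def by fastforce
      moreover have "M + \<sigma> * t \<le> K" using t \<sigma> by (simp add: K_def)
      ultimately show ?thesis by (auto simp: supported_in_def)
    qed
    from smooth_solution_momentum_le_mass[OF sol T pos(3) K(1) this, of j]
    have "integral (cube K) (\<lambda>x. A * (rho d x * \<psi> x)) \<le> m0"
      by (simp add: u_def m0_def mult.left_commute)
    then show False using Am by (simp add: I0_def)
  qed
  \<comment> \<open>Local solvability for the chosen velocity keeps the supremum from being taken
    over the empty set and makes it positive.\<close>
  obtain T U where TU: "smooth_solution c s \<delta> ?d T U"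
    using hyp adm' supp' unfolding locally_solvable_def by blast
  have "0 < T" using TU by (simp add: smooth_solution_def)
  have "ereal T \<le> lifespan c s \<delta> ?d"
    unfolding lifespan_def using TU by (intro Sup_upper) auto
  with \<open>0 < T\<close> have life_pos: "0 < lifespan c s \<delta> ?d" by (metis ereal_less(2) less_le_trans)
  have "lifespan c s \<delta> ?d \<le> ereal 1"
    unfolding lifespan_def using short by (intro Sup_least) auto
  then have life_fin: "lifespan c s \<delta> ?d < \<infinity>" by (metis ereal_infty_less(1) ereal_less_eq(1) PInfty_neq_ereal(1) antisym)
  show "\<exists>u\<^sub>0. let d\<^sub>0 = d\<lparr>vel := u\<^sub>0\<rparr>; \<gamma> = adiabatic_index c; \<rho>max = (SUP x. rho d\<^sub>0 x) in
          admissible_data s \<delta> d\<^sub>0 \<and> supported_in M d\<^sub>0 \<and> G_fun c d\<^sub>0 > 0 \<and>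
          F_fun d\<^sub>0 > max (128 * \<sigma> * \<rho>max / (3 * (5 - 3 * \<gamma>)))
                         (8 * sqrt (pi * \<rho>max) / sqrt (3 * (5 - 3 * \<gamma>))) * M ^ 4 \<and>
          0 < lifespan c s \<delta> d\<^sub>0 \<and> lifespan c s \<delta> d\<^sub>0 < \<infinity>"
    unfolding Let_def
  proof (intro exI[of _ "u A"] conjI)
    show "max (128 * \<sigma> * (SUP x. rho ?d x) / (3 * (5 - 3 * adiabatic_index c)))
      (8 * sqrt (pi * (SUP x. rho ?d x)) / sqrt (3 * (5 - 3 * adiabatic_index c))) * M ^ 4 < F_fun ?d"
      using AB unfolding F B_def by simp
  qed (use adm' supp' AG G life_pos life_fin in auto)
qed

end
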